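(* Let $a\colon\mathbb{R}_+\to\mathbb{R}$ be a Hardy field function such that $t^d\log t\prec a(t)\prec t^{d+1}$ for some $d\in\mathbb{Z}_+$, or $a(t)\sim t^d\log t$ for some $d\in\mathbb{N}$. Let $b(n):=e(a(n))$, $n\in\mathbb{N}$, or $b(n):=e([a(n)]\alpha)$, $n\in\mathbb{N}$, where $\alpha\in\mathbb{R}\setminus\mathbb{Z}$. Then $$\lim_{N\to\infty}\frac1N\sum_{n=1}^N b(n)\,w(n)=0$$ for every ergodic sequence $w\colon\mathbb{N}\to\mathbb{U}$.
   Context: Notation: $\mathbb{N}$ is the set of positive integers, $\mathbb{Z}_+$ the non-negative integers, $\mathbb{U}$ the (closed) complex unit disc, $e(t):=e^{2\pi i t}$, $[t]$ denotes the integer part of $t\in\mathbb{R}$. For functions on $\mathbb{R}_+$: $a(t)\prec b(t)$ means $\lim_{t\to+\infty}a(t)/b(t)=0$; $a(t)\sim b(t)$ means $\lim_{t\to+\infty}a(t)/b(t)$ exists (in $\mathbb{R}$) and is non-zero. Hardy fields: let $B$ be the ring of germs at $+\infty$ of real valued functions defined on half lines $[c,+\infty)$. A Hardy field is a subfield of $B$ closed under differentiation. All Hardy fields are assumed translation invariant: if $a(t)$ belongs to the field, so does $a(t+h)$ for every $h\in\mathbb{R}$. A Hardy field function is a function whose germ belongs to some Hardy field. Ergodic sequences: extend $w\colon\mathbb{N}\to\mathbb{U}$ to $\mathbb{Z}$ arbitrarily (the extension does not matter), let $X:=\mathbb{U}^{\mathbb{Z}}$ and let $T$ be the shift, $(Tx)(n):=x(n+1)$.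 A Furstenberg system of $w$ is a system $(X,\mu,T)$ where $\mu=\lim_{k\to\infty}\frac1{M_k}\sum_{m=1}^{M_k}\delta_{T^m w}$ (weak-star limit) for some strictly increasing sequence $M_k\to\infty$ of positive integers along which the limit exists. The sequence $w$ is ergodic if all its Furstenberg systems are ergodic. *)

theory Defs
  imports "HOL-Probability.Probability"
begin

text \<open>
  Germs at \<open>+\<infinity>\<close>. A function on a half line \<open>[c, +\<infinity>)\<close> is represented by any of its total
  extensions; all of them have the same germ.
\<close>

quotient_type germ = "real \<Rightarrow> real" / "\<lambda>f g. eventually (\<lambda>t. f t = g t) at_top"
  morphisms rep_germ germ_of
proof (rule equivpI)
  show "reflp (\<lambda>(f :: real \<Rightarrow> real) g. eventually (\<lambda>t. f t = g t) at_top)"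
    by (rule reflpI) simp
  show "symp (\<lambda>(f :: real \<Rightarrow> real) g. eventually (\<lambda>t. f t = g t) at_top)"
    by (rule sympI) (simp add: eq_commute)
  show "transp (\<lambda>(f :: real \<Rightarrow> real) g. eventually (\<lambda>t. f t = g t) at_top)"
    by (rule transpI) (auto elim: eventually_elim2)
qed

instantiation germ :: comm_ring_1
begin

lift_definition zero_germ :: germ is "\<lambda>_. 0" .
lift_definition one_germ :: germ is "\<lambda>_. 1" .
lift_definition plus_germ :: "germ \<Rightarrow> germ \<Rightarrow> germ" is "\<lambda>f g t. f t + g t"
  by (auto elim: eventually_elim2)
lift_definition minus_germ :: "germ \<Rightarrow> germ \<Rightarrow> germ" is "\<lambda>f g t. f t - g t"
  by (auto elim: eventually_elim2)
lift_definition uminus_germ :: "germ \<Rightarrow> germ" is "\<lambda>f t. - f t"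
  by simp
lift_definition times_germ :: "germ \<Rightarrow> germ \<Rightarrow> germ" is "\<lambda>f g t. f t * g t"
  by (auto elim: eventually_elim2)

instance
  by standard (transfer; simp add: algebra_simps)+

end

lift_definition germ_translate :: "real \<Rightarrow> germ \<Rightarrow> germ" is "\<lambda>h f t. f (t + h)"
proof -
  fix h :: real and f g :: "real \<Rightarrow> real"
  assume "eventually (\<lambda>t. f t = g t) at_top"
  moreover have "filterlim (\<lambda>t::real. t + h) at_top at_top"
    using filterlim_tendsto_add_at_top[OF tendsto_const[of h] filterlim_ident]
    by (simp add: add.commute)
  ultimately show "eventually (\<lambda>t. f (t + h) = g (t + h)) at_top"
    by (rule eventually_compose_filterlim)
qed

definition germ_has_derivative :: "germ \<Rightarrow> germ \<Rightarrow> bool" where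
  "germ_has_derivative F G \<longleftrightarrow>
     (\<exists>f g. germ_of f = F \<and> germ_of g = G \<and>
        eventually (\<lambda>t. (f has_real_derivative g t) (at t)) at_top)"

definition is_subfield :: "'a::comm_ring_1 set \<Rightarrow> bool" where
  "is_subfield K \<longleftrightarrow>
     0 \<in> K \<and> 1 \<in> K \<and>
     (\<forall>x\<in>K. \<forall>y\<in>K. x + y \<in> K) \<and>
     (\<forall>x\<in>K. - x \<in> K) \<and>
     (\<forall>x\<in>K. \<forall>y\<in>K. x * y \<in> K) \<and>
     (\<forall>x\<in>K. x \<noteq> 0 \<longrightarrow> (\<exists>y\<in>K. x * y = 1))"

text \<open>The last condition is not part of the usual definition; all Hardy fields are assumed to satisfy it.\<close>

definition Hardy_field :: "germ set \<Rightarrow> bool" where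
  "Hardy_field H \<longleftrightarrow>
     is_subfield H \<and>
     (\<forall>F\<in>H. \<exists>G\<in>H. germ_has_derivative F G) \<and>
     (\<forall>F\<in>H. \<forall>h. germ_translate h F \<in> H)"

definition Hardy_field_function :: "(real \<Rightarrow> real) \<Rightarrow> bool" where
  "Hardy_field_function a \<longleftrightarrow> (\<exists>H. Hardy_field H \<and> germ_of a \<in> H)"

text \<open>
  The quotient \<open>a t / b t\<close> has to make sense for large \<open>t\<close>. Without the condition on \<open>b\<close>, the
  convention \<open>x / 0 = 0\<close> would put every function below the zero function.
\<close>

definition growth_prec :: "(real \<Rightarrow> real) \<Rightarrow> (real \<Rightarrow> real) \<Rightarrow> bool" (infix "\<prec>\<^sub>g" 50) where
  "a \<prec>\<^sub>g b \<longleftrightarrow> eventually (\<lambda>t. b t \<noteq> 0) at_top \<and> ((\<lambda>t. a t / b t) \<longlongrightarrow> 0) at_top"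

definition growth_sim :: "(real \<Rightarrow> real) \<Rightarrow> (real \<Rightarrow> real) \<Rightarrow> bool" (infix "\<sim>\<^sub>g" 50) where
  "a \<sim>\<^sub>g b \<longleftrightarrow>
     eventually (\<lambda>t. b t \<noteq> 0) at_top \<and> (\<exists>c. c \<noteq> 0 \<and> ((\<lambda>t. a t / b t) \<longlongrightarrow> c) at_top)"

definition e_unit :: "real \<Rightarrow> complex" where
  "e_unit t = exp (2 * of_real pi * \<i> * of_real t)"

definition unit_disc :: "complex set" where
  "unit_disc = cball 0 1"

text \<open>
  The sequence space carries the product topology, which is the topology of the type
  \<open>int \<Rightarrow> complex\<close> restricted to the set below.
\<close>

definition seq_space :: "(int \<Rightarrow> complex) set" where
  "seq_space = {x. \<forall>n. x n \<in> unit_disc}"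

definition seq_shift :: "(int \<Rightarrow> complex) \<Rightarrow> (int \<Rightarrow> complex)" where
  "seq_shift x = (\<lambda>n. x (n + 1))"

text \<open>
  Sequences on the positive integers are functions on \<open>nat\<close> whose value at \<open>0\<close> is ignored. The
  choice of the extension to the integers does not affect the averages of continuous functions.
\<close>

definition extend_seq :: "(nat \<Rightarrow> complex) \<Rightarrow> (int \<Rightarrow> complex)" where
  "extend_seq w = (\<lambda>k. if k \<ge> 1 then w (nat k) else 0)"

definition Furstenberg_measure :: "(nat \<Rightarrow> complex) \<Rightarrow> (int \<Rightarrow> complex) measure \<Rightarrow> bool" where
  "Furstenberg_measure w \<mu> \<longleftrightarrow>
     prob_space \<mu> \<and> sets \<mu> = sets (restrict_space borel seq_space) \<and>
     (\<exists>M :: nat \<Rightarrow> nat. strict_mono M \<and> (\<forall>k. M k > 0) \<and>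
        (\<forall>F :: (int \<Rightarrow> complex) \<Rightarrow> complex. continuous_on seq_space F \<longrightarrow>
           (\<lambda>k. (\<Sum>m=1..M k. F ((seq_shift ^^ m) (extend_seq w))) / of_nat (M k))
             \<longlonglongrightarrow> (\<integral>x. F x \<partial>\<mu>)))"

definition ergodic_system :: "'a measure \<Rightarrow> ('a \<Rightarrow> 'a) \<Rightarrow> bool" where
  "ergodic_system \<mu> T \<longleftrightarrow>
     (\<forall>A\<in>sets \<mu>. T -` A \<inter> space \<mu> = A \<longrightarrow> measure \<mu> A = 0 \<or> measure \<mu> A = 1)"

definition ergodic_seq :: "(nat \<Rightarrow> complex) \<Rightarrow> bool" where
  "ergodic_seq w \<longleftrightarrow> (\<forall>\<mu>. Furstenberg_measure w \<mu> \<longrightarrow> ergodic_system \<mu> seq_shift)"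

end

theory Submission
  imports Defs
begin

text \<open>
  Applying the van der Corput inequality \<open>d\<close> times replaces \<open>a\<close> by an iterated difference, which behaves
  like \<open>h\<^sub>1 \<cdots> h\<^sub>d\<close> times the \<open>d\<close>-th derivative of \<open>a\<close>, and \<open>w n\<close> by \<open>F (T\<^sup>n w)\<close> with \<open>F\<close> a continuous function
  on the sequence space. Now the phase varies slowly, so \<open>F\<close> may be replaced by its ergodic averages,
  which in every Furstenberg system are close in mean to a constant by ergodicity. What remains is the
  average of the phase alone; if its differences \<open>\<delta>\<^sub>n\<close> decrease to \<open>0\<close> and \<open>n \<delta>\<^sub>n \<ge> \<kappa>\<close>, summation by parts bounds it
  by a multiple of \<open>1 / \<kappa>\<close>. For \<open>t\<^sup>d log t \<prec> a(t)\<close> every \<open>\<kappa>\<close> is allowed, and for \<open>a(t) \<sim> t\<^sup>d log t\<close> the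
  constant \<open>\<kappa>\<close> grows with the shifts \<open>h\<^sub>i\<close>, over which the van der Corput inequality averages.

  For the integer part, \<open>e([x] \<alpha>) = e(x \<alpha>) \<psi>(x)\<close> with \<open>\<psi>\<close> of period one, and trigonometric approximation of \<open>\<psi>\<close>
  leads to the phases \<open>(\<alpha> + k) a(n)\<close>, where \<open>\<alpha> + k \<noteq> 0\<close>.

  Limit measures on the sequence space come from Helly's selection theorem on the real line: a space-filling
  curve of Schoenberg type maps the line continuously onto the sequence space, and orbits are lifted along it.
\<close>

section \<open>Cesaro averages and the van der Corput inequality\<close>

text \<open>A van der Corput step turns \<open>F\<close> into the product of a shifted
  \<open>F\<close> and its conjugate, over whose mean there is no control. The decay must therefore
  come from the phase, and ergodicity enters only after the last step. As the new \<open>F\<close>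
  depends on the shift, the induction hypothesis has to hold with one \<open>\<kappa>\<close> for
  all phases and all \<open>F\<close> at once. Moreover \<open>w\<close> singles out no limit
  measure: a failing bound is refuted along a subsequence of bad \<open>N\<close>, and the length of
  the ergodic averages is chosen after the limit measure is known. For
  \<open>a(t) \<sim> log t\<close> there would be no van der Corput step to enlarge
  \<open>\<kappa>\<close>, and indeed the averages of \<open>e(log n)\<close> do not tend to
  \<open>0\<close>; hence \<open>d \<ge> 1\<close> in that case. For integer parts the obstacle is
  the jump of \<open>\<psi>\<close> at the integers, which excludes uniform approximation by
  trigonometric polynomials. The part near the jump is cut out and dominated by a Fejer kernel,
  whose averages along \<open>a(n)\<close> are known from the case \<open>F = 1\<close>.\<close>

definition cesaro :: "(nat \<Rightarrow> complex) \<Rightarrow> nat \<Rightarrow> complex" where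
  "cesaro u N = (\<Sum>n=1..N. u n) / of_nat N"

lemma cesaro_add: "cesaro (\<lambda>n. u n + v n) N = cesaro u N + cesaro v N"
  by (simp add: cesaro_def sum.distrib add_divide_distrib)

lemma cesaro_diff: "cesaro (\<lambda>n. u n - v n) N = cesaro u N - cesaro v N"
  by (simp add: cesaro_def sum_subtractf diff_divide_distrib)

lemma cesaro_cmult: "cesaro (\<lambda>n. c * u n) N = c * cesaro u N"
  by (simp add: cesaro_def sum_distrib_left)

lemma cesaro_sum: "cesaro (\<lambda>n. \<Sum>i\<in>I. u i n) N = (\<Sum>i\<in>I. cesaro (u i) N)"
  by (simp add: cesaro_def sum.swap[of _ I] sum_divide_distrib)

lemma cesaro_cnj: "cesaro (\<lambda>n. cnj (u n)) N = cnj (cesaro u N)"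
  by (simp add: cesaro_def)

lemma cesaro_cong: "(\<And>n. n \<ge> 1 \<Longrightarrow> u n = v n) \<Longrightarrow> cesaro u N = cesaro v N"
  by (simp add: cesaro_def)

lemma cesaro_const: "N > 0 \<Longrightarrow> cesaro (\<lambda>n. c) N = c"
  by (simp add: cesaro_def)

lemma norm_cesaro_le_Re:
  assumes "\<And>n. n \<ge> 1 \<Longrightarrow> norm (u n) \<le> g n"
  shows "norm (cesaro u N) \<le> Re (cesaro (\<lambda>n. of_real (g n)) N)"
proof -
  have "norm (\<Sum>n=1..N. u n) \<le> (\<Sum>n=1..N. g n)"
    by (rule sum_norm_le) (use assms in auto)
  then have "norm (\<Sum>n=1..N. u n) / N \<le> (\<Sum>n=1..N. g n) / N"
    by (simp add: divide_right_mono)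
  moreover have "Re (cesaro (\<lambda>n. of_real (g n)) N) = (\<Sum>n=1..N. g n) / N"
    by (simp add: cesaro_def Re_divide_of_nat)
  ultimately show ?thesis by (simp add: cesaro_def norm_divide)
qed

lemma norm_cesaro_le:
  assumes "\<And>n. n \<ge> 1 \<Longrightarrow> norm (u n) \<le> B" "B \<ge> 0"
  shows "norm (cesaro u N) \<le> B"
proof (cases "N = 0")
  case False
  then show ?thesis
    using norm_cesaro_le_Re[of u "\<lambda>_. B" N] assms by (simp add: cesaro_const)
qed (use assms in \<open>simp add: cesaro_def\<close>)

lemma cesaro_finite_support:
  assumes "\<And>n. n > m \<Longrightarrow> u n = 0"
  shows "cesaro u \<longlonglongrightarrow> 0"
proof -
  have "\<forall>\<^sub>F N in sequentially. (\<Sum>n=1..m. u n) / of_nat N = cesaro u N"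
  proof (rule eventually_sequentiallyI[of m])
    fix N assume "m \<le> N"
    then have "(\<Sum>n=1..N. u n) = (\<Sum>n=1..m. u n)"
      by (intro sum.mono_neutral_right ballI assms) auto
    then show "(\<Sum>n=1..m. u n) / of_nat N = cesaro u N" by (simp add: cesaro_def)
  qed
  then show ?thesis
    by (rule Lim_transform_eventually[OF lim_const_over_n])
qed

lemma cesaro_tendsto_0:
  assumes "u \<longlonglongrightarrow> 0"
  shows "cesaro u \<longlonglongrightarrow> 0"
proof (rule tendstoI)
  fix e :: real assume "e > 0"
  then obtain m where m: "\<And>n. n \<ge> m \<Longrightarrow> norm (u n) < e / 2"
    using assms[THEN tendstoD, of "e/2"] by (auto simp: eventually_sequentially)
  define v where "v n = (if n \<le> m then u n else 0)" for n
  have "cesaro v \<longlonglongrightarrow> 0" by (rule cesaro_finite_support[of m]) (simp add: v_def)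
  then have "\<forall>\<^sub>F N in sequentially. norm (cesaro v N) < e / 2"
    using \<open>e > 0\<close> by (auto dest: tendstoD[where e = "e/2"])
  then show "\<forall>\<^sub>F N in sequentially. dist (cesaro u N) 0 < e"
  proof eventually_elim
    case (elim N)
    have "norm (cesaro (\<lambda>n. u n - v n) N) \<le> e / 2"
      by (rule norm_cesaro_le) (use m \<open>e > 0\<close> in \<open>auto simp: v_def intro: less_imp_le\<close>)
    then have "norm (cesaro u N - cesaro v N) \<le> e / 2" by (simp add: cesaro_diff)
    with elim show ?case using norm_triangle_sub[of "cesaro u N" "cesaro v N"] by simp
  qed
qed

lemma cesaro_shift:
  assumes "\<And>n. norm (u n) \<le> B"
  shows "(\<lambda>N. cesaro (\<lambda>n. u (n + k)) N - cesaro u N) \<longlonglongrightarrow> 0"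
proof (induction k)
  case (Suc k)
  have eq: "cesaro (\<lambda>n. u (n + Suc k)) N - cesaro (\<lambda>n. u (n + k)) N
            = (u (Suc N + k) - u (1 + k)) / of_nat N" for N
  proof -
    have "(\<Sum>n=1..N. u (Suc n + k) - u (n + k)) = u (Suc N + k) - u (1 + k)"
      using sum_Suc_diff[of 1 N "\<lambda>n. u (n + k)"] by simp
    then show ?thesis by (simp add: cesaro_def sum_subtractf flip: diff_divide_distrib)
  qed
  have "(\<lambda>N. (u (Suc N + k) - u (1 + k)) / of_nat N) \<longlonglongrightarrow> 0"
  proof (rule Lim_null_comparison)
    show "\<forall>\<^sub>F N in sequentially. norm ((u (Suc N + k) - u (1 + k)) / of_nat N) \<le> 2 * B / real N"
      using norm_triangle_le_diff[OF add_mono[OF assms assms]]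
      by (auto intro!: always_eventually divide_right_mono simp: norm_divide simp flip: mult_2)
    show "(\<lambda>N. 2 * B / real N) \<longlonglongrightarrow> 0" by (rule lim_const_over_n)
  qed
  then have "(\<lambda>N. cesaro (\<lambda>n. u (n + Suc k)) N - cesaro (\<lambda>n. u (n + k)) N) \<longlonglongrightarrow> 0"
    by (simp only: eq)
  from tendsto_add[OF this Suc] show ?case by simp
qed simp

text \<open>Cauchy-Schwarz against the constant 1. The mean square is written as a complex average
  so that, for a sum of shifts of \<open>u\<close>, it expands directly into correlations.\<close>

lemma norm_cesaro_power2_le:
  "(norm (cesaro u N))\<^sup>2 \<le> norm (cesaro (\<lambda>n. u n * cnj (u n)) N)"
proof (cases "N = 0")
  case False
  have "(norm (\<Sum>n=1..N. u n))\<^sup>2 \<le> (\<Sum>n=1..N. norm (u n))\<^sup>2"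
    by (intro power_mono norm_sum) auto
  also have "\<dots> \<le> (\<Sum>n=1..N. 1\<^sup>2) * (\<Sum>n=1..N. (norm (u n))\<^sup>2)"
    using Cauchy_Schwarz_ineq_sum[of "\<lambda>_. 1" "\<lambda>n. norm (u n)" "{1..N}"] by simp
  finally have "(norm (\<Sum>n=1..N. u n))\<^sup>2 \<le> N * (\<Sum>n=1..N. (norm (u n))\<^sup>2)" by simp
  then have "(norm (\<Sum>n=1..N. u n))\<^sup>2 / N\<^sup>2 \<le> (\<Sum>n=1..N. (norm (u n))\<^sup>2) / N"
    using False by (simp add: field_simps power2_eq_square)
  moreover have "norm (cesaro (\<lambda>n. u n * cnj (u n)) N) = (\<Sum>n=1..N. (norm (u n))\<^sup>2) / N"
  proof -
    have "(\<Sum>n=1..N. u n * cnj (u n)) = of_real (\<Sum>n=1..N. (norm (u n))\<^sup>2)"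
      by (simp only: of_real_sum complex_norm_square)
    then show ?thesis
      by (simp only: cesaro_def norm_divide norm_of_real) (simp add: sum_nonneg)
  qed
  ultimately show ?thesis by (simp only: cesaro_def norm_divide power_divide norm_of_nat of_nat_power)
qed (simp add: cesaro_def)

text \<open>Shifting only by multiples of a large step \<open>h0\<close> makes all off-diagonal correlations small.\<close>

theorem van_der_Corput:
  fixes u :: "nat \<Rightarrow> complex"
  assumes bd: "\<And>n. norm (u n) \<le> 1"
    and corr: "\<And>e. e > 0 \<Longrightarrow> \<exists>h0. \<forall>h\<ge>h0. \<forall>\<^sub>F N in sequentially.
                 norm (cesaro (\<lambda>n. u (n + h) * cnj (u n)) N) \<le> e"
  shows "cesaro u \<longlonglongrightarrow> 0"
proof (rule tendstoI)
  fix e :: real assume e: "e > 0"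
  \<comment> \<open>The \<open>H\<close> diagonal terms contribute at most \<open>H * H * e'\<close>
    because \<open>H > 1 / e'\<close>, the others at most \<open>2 * H * H * e'\<close>. The total
    is three sixteenths of \<open>(H * e)\<^sup>2\<close> and stays below
    \<open>(H * e / 2)\<^sup>2\<close>.\<close>
  define e' where "e' = e\<^sup>2 / 16"
  have e': "e' > 0" using e by (simp add: e'_def)
  obtain h0 where h0: "\<And>h. h \<ge> h0 \<Longrightarrow> \<forall>\<^sub>F N in sequentially.
                 norm (cesaro (\<lambda>n. u (n + h) * cnj (u n)) N) \<le> e'"
    using corr[OF e'] by blast
  define s where "s = Suc h0"
  obtain H :: nat where H: "1 / e' < H" using reals_Archimedean2 by blast
  have "H > 0" using H e' by (metis divide_pos_pos less_trans of_nat_0_less_iff zero_less_one)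
  have cbd: "norm (u (n + i) * cnj (u (n + j))) \<le> 1" for n i j
    using mult_mono[OF bd[of "n+i"] bd[of "n+j"]] by (simp add: norm_mult)
  \<comment> \<open>The second \<open>e'\<close> pays for moving the base point from
    \<open>n + j * s\<close> back to \<open>n\<close>.\<close>
  have low: "\<forall>\<^sub>F N in sequentially. norm (cesaro (\<lambda>n. u (n + i * s) * cnj (u (n + j * s))) N) \<le> 2 * e'"
    if "j < i" for i j
  proof -
    define h where "h = i * s - j * s"
    have i: "i * s = h + j * s" using that by (simp add: h_def)
    have "h \<ge> h0"
    proof -
      have "h = (i - j) * s" by (simp add: h_def diff_mult_distrib)
      also have "\<dots> \<ge> 1 * s" using that by (intro mult_right_mono) auto
      finally show ?thesis by (simp add: s_def)
    qed
    have "\<forall>\<^sub>F N in sequentially. dist (cesaro (\<lambda>n. u (n + j * s + h) * cnj (u (n + j * s))) N -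
        cesaro (\<lambda>n. u (n + h) * cnj (u n)) N) 0 < e'"
      by (rule tendstoD[OF _ e'], rule cesaro_shift[of "\<lambda>n. u (n + h) * cnj (u n)" 1 "j * s"])
         (use cbd[of _ h 0] in simp)
    with h0[OF \<open>h \<ge> h0\<close>] show ?thesis
    proof eventually_elim
      case (elim N)
      then show ?case
        using norm_triangle_sub[of "cesaro (\<lambda>n. u (n + j * s + h) * cnj (u (n + j * s))) N"
            "cesaro (\<lambda>n. u (n + h) * cnj (u n)) N"]
        by (simp add: i ac_simps)
    qed
  qed
  have off: "\<forall>\<^sub>F N in sequentially. norm (cesaro (\<lambda>n. u (n + i * s) * cnj (u (n + j * s))) N) \<le> 2 * e'"
    if "i \<noteq> j" for i j
  proof (cases "j < i")
    case False
    then have "i < j" using that by simp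
    from low[OF this] show ?thesis
      using cesaro_cnj[of "\<lambda>n. u (n + j * s) * cnj (u (n + i * s))"] by (simp add: mult.commute)
  qed (rule low)
  have "\<forall>\<^sub>F N in sequentially. \<forall>i\<in>{..<H}. \<forall>j\<in>{..<H} - {i}.
          norm (cesaro (\<lambda>n. u (n + i * s) * cnj (u (n + j * s))) N) \<le> 2 * e'"
    by (intro eventually_ball_finite ballI off) auto
  \<comment> \<open>The tolerance \<open>e / 4\<close> for each shift is added to the bound
    \<open>e / 2\<close> for the average over the \<open>H\<close> shifts; the sum is below
    \<open>e\<close>.\<close>
  moreover have "\<forall>\<^sub>F N in sequentially. \<forall>i\<in>{..<H}. dist (cesaro (\<lambda>n. u (n + i * s)) N - cesaro u N) 0 < e / 4"
    by (intro eventually_ball_finite ballI tendstoD[OF cesaro_shift[OF bd]]) (use e in auto)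
  ultimately show "\<forall>\<^sub>F N in sequentially. dist (cesaro u N) 0 < e"
  proof eventually_elim
    case (elim N)
    define A where "A = cesaro (\<lambda>n. \<Sum>i<H. u (n + i * s)) N"
    have "(norm A)\<^sup>2 \<le> norm (cesaro (\<lambda>n. (\<Sum>i<H. u (n + i * s)) * cnj (\<Sum>j<H. u (n + j * s))) N)"
      unfolding A_def by (rule norm_cesaro_power2_le)
    also have "\<dots> = norm (\<Sum>i<H. \<Sum>j<H. cesaro (\<lambda>n. u (n + i * s) * cnj (u (n + j * s))) N)"
      by (simp add: sum_product cesaro_sum)
    also have "\<dots> \<le> (\<Sum>i<H. 1 + real H * (2 * e'))"
    proof (rule sum_norm_le)
      fix i assume i: "i \<in> {..<H}"
      have "norm (\<Sum>j<H. cesaro (\<lambda>n. u (n + i * s) * cnj (u (n + j * s))) N)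
            = norm (cesaro (\<lambda>n. u (n + i * s) * cnj (u (n + i * s))) N +
              (\<Sum>j\<in>{..<H}-{i}. cesaro (\<lambda>n. u (n + i * s) * cnj (u (n + j * s))) N))"
        using i by (subst sum.remove[of _ i]) auto
      also have "\<dots> \<le> 1 + (\<Sum>j\<in>{..<H}-{i}. 2 * e')"
        by (rule norm_triangle_mono[OF norm_cesaro_le[OF cbd] sum_norm_le]) (use elim i in auto)
      also have "(\<Sum>j\<in>{..<H}-{i}. 2 * e') \<le> (\<Sum>j\<in>{..<H}. 2 * e')"
        by (rule sum_mono2) (use e' in auto)
      finally show "norm (\<Sum>j<H. cesaro (\<lambda>n. u (n + i * s) * cnj (u (n + j * s))) N)
           \<le> 1 + real H * (2 * e')" by simp
    qed
    also have "\<dots> = H * (1 + H * (2 * e'))" by simp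
    also have "\<dots> \<le> H * (H * e' + H * (2 * e'))"
      using H e' by (intro mult_left_mono add_right_mono) (auto simp: field_simps)
    also have "\<dots> \<le> (H * e / 2)\<^sup>2" using e by (simp add: e'_def power2_eq_square field_simps)
    finally have A: "norm A \<le> H * e / 2"
      using e by (simp add: power2_le_iff_abs_le)
    have "A - of_nat H * cesaro u N = (\<Sum>i<H. cesaro (\<lambda>n. u (n + i * s)) N - cesaro u N)"
      by (simp add: A_def cesaro_sum sum_subtractf)
    also have "norm \<dots> \<le> (\<Sum>i<H. e / 4)"
      by (rule sum_norm_le) (use elim in \<open>auto intro: less_imp_le\<close>)
    finally have "norm (A - of_nat H * cesaro u N) \<le> H * e / 4" by simp
    then have "norm (of_nat H * cesaro u N) \<le> H * e / 2 + H * e / 4"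
      using A norm_triangle_sub[of "of_nat H * cesaro u N" A] norm_minus_commute[of A "of_nat H * cesaro u N"] by linarith
    also have "\<dots> < H * e" using \<open>H > 0\<close> e by (simp add: field_simps)
    finally have "H * norm (cesaro u N) < H * e" by (simp add: norm_mult)
    then show ?case using \<open>H > 0\<close> by simp
  qed
qed

section \<open>The exponential phase and summation by parts\<close>

lemma e_unit_0 [simp]: "e_unit 0 = 1"
  and e_unit_add: "e_unit (s + t) = e_unit s * e_unit t"
  by (simp_all add: e_unit_def exp_add algebra_simps)

lemma e_unit_eq_cis: "e_unit t = cis (2 * pi * t)"
  by (simp add: e_unit_def cis_conv_exp mult_ac)

lemma norm_e_unit [simp]: "norm (e_unit t) = 1"
  by (simp add: e_unit_eq_cis)

lemma cnj_e_unit: "cnj (e_unit t) = e_unit (- t)"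
  by (simp add: e_unit_eq_cis cis_cnj)

lemma e_unit_diff: "e_unit (s - t) = e_unit s * cnj (e_unit t)"
  using e_unit_add[of s "-t"] by (simp add: cnj_e_unit)

lemma continuous_e_unit [continuous_intros]:
  "continuous_on S f \<Longrightarrow> continuous_on S (\<lambda>x. e_unit (f x))"
  unfolding e_unit_def by (intro continuous_intros)

lemma isCont_e_unit: "isCont e_unit t"
  using continuous_e_unit[of UNIV "\<lambda>x. x"] by (simp add: continuous_on_eq_continuous_at)

text \<open>Once the boundary term \<open>E (Suc N) * p N\<close> is subtracted, each further
  summand changes the rest by at most \<open>p (Suc N) - p N\<close>, so the rest stays below
  \<open>p N\<close> by induction. The boundary term costs another \<open>p N\<close>.\<close>

lemma norm_Abel_sum_le:
  fixes E :: "nat \<Rightarrow> complex" and p :: "nat \<Rightarrow> real"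
  assumes E: "\<And>n. norm (E n) \<le> 1" and p: "\<And>n. n \<ge> m \<Longrightarrow> p n \<le> p (Suc n)" "p m \<ge> 0" and "m \<le> N"
  shows "norm (\<Sum>n=m..N. (E (Suc n) - E n) * p n) \<le> 2 * p N"
proof -
  have "p N \<ge> 0 \<and> norm ((\<Sum>n=m..N. (E (Suc n) - E n) * p n) - E (Suc N) * p N) \<le> p N"
    using \<open>m \<le> N\<close>
  proof (induction N rule: dec_induct)
    case base
    have "(E (Suc m) - E m) * p m - E (Suc m) * p m = - (E m * p m)"
      by (simp add: algebra_simps)
    then show ?case
      using mult_right_mono[OF E[of m] p(2)] p(2) by (simp add: norm_mult)
  next
    case (step N)
    have "(\<Sum>n=m..Suc N. (E (Suc n) - E n) * p n) - E (Suc (Suc N)) * p (Suc N) =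
      ((\<Sum>n=m..N. (E (Suc n) - E n) * p n) - E (Suc N) * p N) - E (Suc N) * of_real (p (Suc N) - p N)"
      using step by (simp add: algebra_simps)
    also have "norm \<dots> \<le> p N + 1 * (p (Suc N) - p N)"
    proof (rule norm_triangle_le_diff, rule add_mono)
      show "norm (E (Suc N) * of_real (p (Suc N) - p N)) \<le> 1 * (p (Suc N) - p N)"
        unfolding norm_mult norm_of_real using E[of "Suc N"] p(1)[of N] step by (intro mult_mono) auto
    qed (use step in auto)
    finally show ?case using step p(1)[of N] by simp
  qed
  then have "norm ((\<Sum>n=m..N. (E (Suc n) - E n) * p n) - E (Suc N) * p N) \<le> p N" "p N \<ge> 0" by auto
  moreover have "norm (E (Suc N) * p N) \<le> p N"
    using mult_right_mono[OF E[of "Suc N"] \<open>p N \<ge> 0\<close>] \<open>p N \<ge> 0\<close> by (simp add: norm_mult)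
  ultimately show ?thesis
    using norm_triangle_sub[of "\<Sum>n=m..N. (E (Suc n) - E n) * p n" "E (Suc N) * p N"] by simp
qed

text \<open>An argument of Kusmin-Landau type. Since
  \<open>E (Suc n) = E n * e_unit (\<delta> n)\<close> and \<open>\<delta>\<close> tends to 0,
  \<open>E n\<close> is asymptotically \<open>q n\<close>, the increment of \<open>E\<close> divided
  by \<open>2 * pi * \<i> * \<delta> n\<close>. The weights \<open>1 / \<delta> n\<close> increase,
  so summation by parts bounds the sum of \<open>q\<close> by \<open>1 / (pi * \<delta> N)\<close>,
  which is at most \<open>N / (\<kappa> * pi)\<close>.\<close>

lemma cesaro_e_unit_slow:
  fixes f \<delta> :: "nat \<Rightarrow> real"
  defines "\<delta> \<equiv> \<lambda>n. f (Suc n) - f n"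
  assumes lim: "\<delta> \<longlonglongrightarrow> 0"
    and dec: "\<forall>\<^sub>F n in sequentially. \<delta> (Suc n) \<le> \<delta> n"
    and low: "\<forall>\<^sub>F n in sequentially. \<kappa> \<le> n * \<delta> n" and "\<kappa> > 0"
  shows "\<forall>\<^sub>F N in sequentially. norm (cesaro (\<lambda>n. e_unit (f n)) N) \<le> 1 / \<kappa>"
proof -
  obtain m where m: "\<And>n. n \<ge> m \<Longrightarrow> \<delta> (Suc n) \<le> \<delta> n" "\<And>n. n \<ge> m \<Longrightarrow> \<kappa> \<le> n * \<delta> n"
    using eventually_conj[OF dec low] by (auto simp: eventually_sequentially)
  have pos: "\<delta> n > 0" if "n \<ge> m" for n
  proof -
    have "0 < real n * \<delta> n" using m(2)[OF that] \<open>\<kappa> > 0\<close> by linarith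
    then show ?thesis by (simp add: zero_less_mult_iff)
  qed
  define E where "E n = e_unit (f n)" for n
  define p where "p n = 1 / \<delta> n" for n
  define q where "q n = (if n \<ge> m then (E (Suc n) - E n) * p n / (2 * pi * \<i>) else 0)" for n
  have "(\<lambda>n. E n - q n) \<longlonglongrightarrow> 0"
  proof (rule Lim_null_comparison)
    show "\<forall>\<^sub>F n in sequentially. norm (E n - q n) \<le> norm (1 - (e_unit (\<delta> n) - 1) / \<delta> n / (2 * pi * \<i>))"
    proof (rule eventually_sequentiallyI[of m])
      fix n assume "m \<le> n"
      have "E (Suc n) = E n * e_unit (\<delta> n)"
        by (simp add: E_def \<delta>_def flip: e_unit_add)
      then have "E n - q n = E n * (1 - (e_unit (\<delta> n) - 1) / \<delta> n / (2 * pi * \<i>))"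
        using \<open>m \<le> n\<close> by (simp add: q_def p_def divide_simps) (simp add: algebra_simps)
      then show "norm (E n - q n) \<le> norm (1 - (e_unit (\<delta> n) - 1) / \<delta> n / (2 * pi * \<i>))"
        by (simp only: norm_mult) (simp add: E_def)
    qed
    have "((\<lambda>z::complex. (exp (2 * of_real pi * \<i> * z) - 1) / z) \<longlongrightarrow> 2 * pi * \<i>) (at 0)"
    proof -
      have "((\<lambda>z. exp (2 * of_real pi * \<i> * z)) has_field_derivative 2 * pi * \<i>) (at 0)"
        by (auto intro!: derivative_eq_intros)
      then show ?thesis by (simp add: DERIV_def)
    qed
    moreover have "filterlim (\<lambda>n. complex_of_real (\<delta> n)) (at 0) sequentially"
      unfolding filterlim_at
    proof
      show "\<forall>\<^sub>F x in sequentially. complex_of_real (\<delta> x) \<in> UNIV \<and> complex_of_real (\<delta> x) \<noteq> 0"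
        by (rule eventually_sequentiallyI[of m]) (use pos in force)
      show "(\<lambda>n. complex_of_real (\<delta> n)) \<longlonglongrightarrow> 0" using tendsto_of_real[OF lim] by simp
    qed
    ultimately have "(\<lambda>n. (e_unit (\<delta> n) - 1) / \<delta> n) \<longlonglongrightarrow> 2 * pi * \<i>"
      unfolding e_unit_def by (rule filterlim_compose)
    then have "(\<lambda>n. norm (1 - (e_unit (\<delta> n) - 1) / \<delta> n / (2 * pi * \<i>))) \<longlonglongrightarrow> norm (1 - 2 * pi * \<i> / (2 * pi * \<i>))"
      by (intro tendsto_intros) auto
    then show "(\<lambda>n. norm (1 - (e_unit (\<delta> n) - 1) / \<delta> n / (2 * pi * \<i>))) \<longlonglongrightarrow> 0" by simp
  qed
  then have "(\<lambda>N. cesaro E N - cesaro q N) \<longlonglongrightarrow> 0"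
    using cesaro_tendsto_0[of "\<lambda>n. E n - q n"] by (simp add: cesaro_diff[abs_def])
  \<comment> \<open>The gap between the bound from summation by parts and the claimed one absorbs
    the error of replacing \<open>E\<close> by \<open>q\<close>.\<close>
  moreover have "1 / \<kappa> - 1 / (\<kappa> * pi) > 0"
    using \<open>\<kappa> > 0\<close> pi_gt3 by (simp add: field_simps)
  ultimately have "\<forall>\<^sub>F N in sequentially. dist (cesaro E N - cesaro q N) 0 < 1 / \<kappa> - 1 / (\<kappa> * pi)"
    by (rule tendstoD)
  moreover have "\<forall>\<^sub>F N in sequentially. N \<ge> Suc m" by (rule eventually_ge_at_top)
  ultimately show ?thesis
  proof eventually_elim
    case (elim N)
    have dm: "\<delta> (Suc n) \<le> \<delta> n" "\<delta> (Suc n) > 0" "\<delta> n > 0" if "n \<ge> m" for n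
      using m(1) pos that by auto
    have "(\<Sum>n=1..N. q n) = (\<Sum>n=max m 1..N. (E (Suc n) - E n) * p n / (2 * pi * \<i>))"
      by (rule sum.mono_neutral_cong_right) (auto simp: q_def)
    also have "\<dots> = (\<Sum>n=max m 1..N. (E (Suc n) - E n) * p n) / (2 * pi * \<i>)"
      by (simp add: sum_divide_distrib)
    also have "norm \<dots> \<le> 2 * p N / (2 * pi)"
      unfolding norm_divide
    proof (rule frac_le)
      show "norm (\<Sum>n=max m 1..N. (E (Suc n) - E n) * p n) \<le> 2 * p N"
        by (rule norm_Abel_sum_le) (use dm elim less_imp_le[OF pos[of "max m 1"]] in \<open>auto simp: E_def p_def intro!: divide_left_mono\<close>)
    qed (use pos[of N] elim in \<open>auto simp: p_def norm_mult\<close>)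
    also have "\<dots> \<le> (N / \<kappa>) / pi"
    proof -
      have "p N \<le> N / \<kappa>"
        using m(2)[of N] pos[of N] elim \<open>\<kappa> > 0\<close> by (simp add: p_def field_simps)
      from divide_right_mono[OF this, of pi] show ?thesis by simp
    qed
    finally have "norm (cesaro q N) \<le> 1 / (\<kappa> * pi)"
      using elim by (simp add: cesaro_def norm_divide field_simps)
    then show ?case
      using elim norm_triangle_sub[of "cesaro E N" "cesaro q N"] by (simp add: E_def[abs_def])
  qed
qed

section \<open>Weak limits of orbit averages\<close>

definition schoenberg_bump :: "real \<Rightarrow> real" where
  "schoenberg_bump t = max 0 (min 1 (1/2 - cos (pi * t)))"

text \<open>\<open>schoenberg_bump\<close> has period 2, is 0 on \<open>{0..1/3}\<close> and 1 on
  \<open>{2/3..1}\<close>, so it reads off one ternary digit that is 0 or 2. Coordinate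
  \<open>j\<close> uses the digits at the positions \<open>prod_encode (j, k)\<close> as its binary
  digits; distinct coordinates read disjoint sets of positions, which makes them
  independent.\<close>

definition schoenberg_coord :: "nat \<Rightarrow> real \<Rightarrow> real" where
  "schoenberg_coord j t = (\<Sum>k. (1/2) ^ Suc k * schoenberg_bump (3 ^ prod_encode (j, k) * t))"

lemma schoenberg_bump_bounds: "0 \<le> schoenberg_bump t" "schoenberg_bump t \<le> 1"
  by (auto simp: schoenberg_bump_def)

lemma schoenberg_bump_periodic: "schoenberg_bump (t + 2 * real n) = schoenberg_bump t"
proof (induction n)
  case (Suc n)
  have "cos (pi * (t + 2 * real (Suc n))) = cos (pi * (t + 2 * real n) + 2 * pi)"
    by (simp add: algebra_simps)
  also have "\<dots> = cos (pi * (t + 2 * real n))" by (rule cos_periodic)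
  finally show ?case using Suc by (simp add: schoenberg_bump_def)
qed simp

lemma schoenberg_bump_eq_0: "0 \<le> t \<Longrightarrow> t \<le> 1/3 \<Longrightarrow> schoenberg_bump t = 0"
proof -
  assume "0 \<le> t" "t \<le> 1/3"
  then have "cos (pi / 3) \<le> cos (pi * t)" by (intro cos_monotone_0_pi_le) auto
  then show ?thesis by (simp add: schoenberg_bump_def cos_60)
qed

lemma schoenberg_bump_eq_1: "2/3 \<le> t \<Longrightarrow> t \<le> 1 \<Longrightarrow> schoenberg_bump t = 1"
proof -
  assume "2/3 \<le> t" "t \<le> 1"
  then have "cos (pi * t) \<le> cos (pi * (2/3))" by (intro cos_monotone_0_pi_le) auto
  also have "pi * (2/3) = pi - pi/3" by simp
  also have "cos (pi - pi/3) = - (1/2)" by (simp only: cos_diff) (simp add: cos_60)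
  finally show ?thesis by (simp add: schoenberg_bump_def)
qed

lemma schoenberg_summand_bound:
  "norm ((1/2) ^ Suc k * schoenberg_bump t) \<le> (1/2::real) ^ Suc k"
  using schoenberg_bump_bounds[of t] by (simp add: abs_mult mult_left_le)

lemma continuous_schoenberg_coord: "continuous_on UNIV (schoenberg_coord j)"
proof -
  have "uniform_limit UNIV
     (\<lambda>n t. \<Sum>k<n. (1/2) ^ Suc k * schoenberg_bump (3 ^ prod_encode (j, k) * t))
     (\<lambda>t. \<Sum>k. (1/2) ^ Suc k * schoenberg_bump (3 ^ prod_encode (j, k) * t)) sequentially"
    by (rule Weierstrass_m_test[where M = "\<lambda>k. (1/2) ^ Suc k"])
       (use schoenberg_summand_bound power_half_series in \<open>auto simp only: sums_iff\<close>)
  then have "uniform_limit UNIV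
     (\<lambda>n t. \<Sum>k<n. (1/2) ^ Suc k * schoenberg_bump (3 ^ prod_encode (j, k) * t))
     (schoenberg_coord j) sequentially"
    by (simp add: schoenberg_coord_def[abs_def])
  then show ?thesis
    by (rule uniform_limit_theorem[rotated])
       (auto simp: schoenberg_bump_def intro!: always_eventually continuous_intros)
qed

lemma schoenberg_coord_bounds: "0 \<le> schoenberg_coord j t" "schoenberg_coord j t \<le> 1"
proof -
  have 1: "(\<lambda>k. (1/2::real) ^ Suc k) sums 1" by (rule power_half_series)
  have 2: "summable (\<lambda>k. (1/2) ^ Suc k * schoenberg_bump (3 ^ prod_encode (j, k) * t))"
    by (rule summable_comparison_test'[OF sums_summable[OF 1]]) (rule schoenberg_summand_bound)
  show "0 \<le> schoenberg_coord j t"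
    unfolding schoenberg_coord_def
    by (rule suminf_nonneg[OF 2]) (simp add: schoenberg_bump_bounds)
  have "schoenberg_coord j t \<le> (\<Sum>k. (1/2) ^ Suc k)"
    unfolding schoenberg_coord_def
    using schoenberg_summand_bound by (intro suminf_le[OF _ 2 sums_summable[OF 1]]) (metis abs_le_D1 real_norm_def)
  then show "schoenberg_coord j t \<le> 1" using 1 by (simp only: sums_iff)
qed

lemma binary_expansion:
  fixes v :: real
  assumes "0 \<le> v" "v \<le> 1"
  shows "\<exists>b :: nat \<Rightarrow> nat. (\<forall>k. b k \<le> 1) \<and> (\<lambda>k. (1/2) ^ Suc k * real (b k)) sums v"
\<comment> \<open>The floor digits have no integer part to start from only when
  \<open>v < 1\<close>, that is \<open>s 0 = 0\<close>; the point 1 gets the expansion with all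
  digits 1.\<close>
proof (cases "v = 1")
  case True
  then show ?thesis using power_half_series by (intro exI[of _ "\<lambda>_. 1"]) simp
next
  case False
  define s where "s n = real_of_int \<lfloor>2 ^ n * v\<rfloor> / 2 ^ n" for n :: nat
  define c where "c n = \<lfloor>2 ^ Suc n * v\<rfloor> - 2 * \<lfloor>2 ^ n * v\<rfloor>" for n :: nat
  have c: "0 \<le> c n" "c n \<le> 1" for n
    unfolding c_def power_Suc by linarith+
  have "s \<longlonglongrightarrow> v"
  proof (rule tendsto_sandwich)
    show "\<forall>\<^sub>F n in sequentially. v - (1/2) ^ n \<le> s n"
    proof (intro always_eventually allI)
      fix n :: nat
      have "2 ^ n * v - 1 \<le> \<lfloor>2 ^ n * v\<rfloor>" by linarith
      then have "(2 ^ n * v - 1) / 2 ^ n \<le> s n" unfolding s_def by (intro divide_right_mono) auto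
      then show "v - (1/2) ^ n \<le> s n" by (simp add: field_simps power_divide)
    qed
    show "\<forall>\<^sub>F n in sequentially. s n \<le> v"
      by (auto simp: s_def divide_le_eq mult.commute intro!: always_eventually)
    have "(\<lambda>n. v - (1/2) ^ n) \<longlonglongrightarrow> v - 0"
      by (intro tendsto_intros LIMSEQ_power_zero) auto
    then show "(\<lambda>n. v - (1/2) ^ n) \<longlonglongrightarrow> v" by simp
  qed simp
  then have "(\<lambda>n. s (Suc n) - s n) sums (v - s 0)" by (rule telescope_sums)
  moreover have "s 0 = 0" using assms False by (simp add: s_def floor_eq_iff)
  moreover have "s (Suc n) - s n = (1/2) ^ Suc n * real (nat (c n))" for n
  proof -
    have "real (nat (c n)) = of_int (c n)" using c by simp
    also have "\<dots> = of_int \<lfloor>2 ^ Suc n * v\<rfloor> - 2 * of_int \<lfloor>2 ^ n * v\<rfloor>" by (simp add: c_def)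
    finally show ?thesis by (simp add: s_def field_simps power_divide)
  qed
  ultimately have "(\<lambda>k. (1/2) ^ Suc k * real (nat (c k))) sums v" by simp
  then show ?thesis using c by (intro exI[of _ "\<lambda>k. nat (c k)"]) (simp add: nat_le_iff)
qed

definition cantor_point :: "(nat \<Rightarrow> nat) \<Rightarrow> real" where
  "cantor_point b = (\<Sum>m. 2 * real (b m) / 3 ^ Suc m)"

lemma cantor_point_props:
  assumes b: "\<And>m. b m \<le> 1"
  shows "3 * cantor_point b = 2 * real (b 0) + cantor_point (\<lambda>m. b (Suc m))"
    and "0 \<le> cantor_point b" and "cantor_point b \<le> 1"
proof -
  have 1: "(\<lambda>m. 2 * (1/3::real) ^ Suc m) sums 1"
    using sums_mult[OF geometric_sums[of "1/3::real"], of "2/3"] by simp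
  have le: "2 * real (b m) / 3 ^ Suc m \<le> 2 * (1/3) ^ Suc m" for m
    using b[of m] by (simp add: field_simps power_divide)
  have 2: "summable (\<lambda>m. 2 * real (b m) / 3 ^ Suc m)"
    by (rule summable_comparison_test'[OF sums_summable[OF 1]]) (use le in simp)
  have "cantor_point b - 2 * real (b 0) / 3 = (\<Sum>m. 2 * real (b (Suc m)) / 3 ^ Suc (Suc m))"
    using suminf_split_head[OF 2] by (simp add: cantor_point_def)
  also have "\<dots> = (\<Sum>m. (2 * real (b (Suc m)) / 3 ^ Suc m) / 3)" by (simp add: field_simps)
  also have "\<dots> = cantor_point (\<lambda>m. b (Suc m)) / 3"
  proof -
    have "summable (\<lambda>m. 2 * real (b (Suc m)) / 3 ^ Suc m)"
      using summable_mult[OF 2[THEN summable_Suc_iff[THEN iffD2]], of 3] by simp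
    then show ?thesis unfolding cantor_point_def by (rule suminf_divide)
  qed
  finally show "3 * cantor_point b = 2 * real (b 0) + cantor_point (\<lambda>m. b (Suc m))"
    by (simp add: field_simps)
  show "0 \<le> cantor_point b" unfolding cantor_point_def by (rule suminf_nonneg[OF 2]) simp
  show "cantor_point b \<le> 1"
    using suminf_le[OF le 2 sums_summable[OF 1]] 1 by (simp add: cantor_point_def sums_iff)
qed

text \<open>Tripling splits off the first ternary digit as the even integer \<open>2 * b 0\<close>,
  which the period 2 of the bump ignores even after further multiplication by powers of 3. At
  \<open>m = 0\<close> the point lies in \<open>{0..1/3}\<close> or \<open>{2/3..1}\<close>
  according to its first digit.\<close>

lemma schoenberg_bump_cantor_point:
  assumes "\<And>m. b m \<le> 1"
  shows "schoenberg_bump (3 ^ m * cantor_point b) = b m"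
  using assms
proof (induction m arbitrary: b)
  case 0
  note p = cantor_point_props[of b] cantor_point_props[of "\<lambda>m. b (Suc m)"]
  consider "b 0 = 0" | "b 0 = 1" using 0[of 0] by linarith
  then show ?case
    by cases (use p 0 in \<open>auto intro!: schoenberg_bump_eq_0 schoenberg_bump_eq_1\<close>)
next
  case (Suc m)
  have "3 ^ Suc m * cantor_point b = 3 ^ m * (3 * cantor_point b)" by simp
  also have "\<dots> = 3 ^ m * cantor_point (\<lambda>m. b (Suc m)) + 2 * real (3 ^ m * b 0)"
    by (subst cantor_point_props(1)) (use Suc in \<open>auto simp: algebra_simps\<close>)
  finally have "schoenberg_bump (3 ^ Suc m * cantor_point b) =
      schoenberg_bump (3 ^ m * cantor_point (\<lambda>m. b (Suc m)))"
    by (simp only: schoenberg_bump_periodic)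
  also have "\<dots> = b (Suc m)" using Suc by simp
  finally show ?case .
qed

lemma schoenberg_surj:
  assumes "\<And>j. 0 \<le> v j" "\<And>j. v j \<le> 1"
  shows "\<exists>t\<in>{0..1}. \<forall>j. schoenberg_coord j t = v j"
proof -
  have "\<forall>j. \<exists>b :: nat \<Rightarrow> nat. (\<forall>k. b k \<le> 1) \<and> (\<lambda>k. (1/2) ^ Suc k * real (b k)) sums v j"
    using binary_expansion assms by blast
  then obtain b :: "nat \<Rightarrow> nat \<Rightarrow> nat"
    where b: "\<And>j k. b j k \<le> 1" "\<And>j. (\<lambda>k. (1/2) ^ Suc k * real (b j k)) sums v j"
    by metis
  define c where "c m = case_prod b (prod_decode m)" for m
  have c: "c m \<le> 1" for m using b(1) by (simp add: c_def case_prod_beta)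
  have "schoenberg_coord j (cantor_point c) = v j" for j
    using b(2)[of j] by (simp only: schoenberg_coord_def schoenberg_bump_cantor_point[OF c])
      (simp add: c_def sums_iff)
  then show ?thesis using cantor_point_props[OF c] by (intro bexI[of _ "cantor_point c"]) auto
qed

lemma complex_polar_e_unit: "z = of_real (norm z) * e_unit (Arg2pi z / (2 * pi))"
  using Arg2pi[of z] by (simp add: is_Arg_def e_unit_def mult_ac)

text \<open>Points of the disc are written in polar form: for the entry at \<open>k\<close>, the
  coordinate \<open>2 * int_encode k\<close> gives the modulus and the next one the angle as a
  fraction of a full turn. The same image over \<open>{0..1}\<close> as over the line lets orbits be
  lifted into a bounded interval.\<close>

lemma seq_space_curve:
  obtains c :: "real \<Rightarrow> int \<Rightarrow> complex"
  where "continuous_on UNIV c" "range c = seq_space" "c ` {0..1} = seq_space"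
proof
  define cl :: "real \<Rightarrow> real" where "cl t = max 0 (min 1 t)" for t
  define c where "c t = (\<lambda>k. of_real (schoenberg_coord (2 * int_encode k) (cl t)) *
      e_unit (schoenberg_coord (2 * int_encode k + 1) (cl t)))" for t
  have cl: "continuous_on UNIV cl" unfolding cl_def by (intro continuous_intros)
  have "continuous_on UNIV (\<lambda>t. schoenberg_coord j (cl t))" for j
    by (rule continuous_on_compose2[OF continuous_schoenberg_coord cl]) simp
  then show "continuous_on UNIV c"
    unfolding c_def by (intro continuous_intros)
  have sub: "range c \<subseteq> seq_space"
    using schoenberg_coord_bounds
    by (auto simp: c_def seq_space_def unit_disc_def norm_mult)
  have sup: "seq_space \<subseteq> c ` {0..1}"
  proof
    fix x assume x: "x \<in> seq_space"
    define v where "v j = (if even j then norm (x (int_decode (j div 2)))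
        else Arg2pi (x (int_decode (j div 2))) / (2 * pi))" for j
    have "0 \<le> v j \<and> v j \<le> 1" for j
      using x Arg2pi_ge_0[of "x (int_decode (j div 2))"] Arg2pi_lt_2pi[of "x (int_decode (j div 2))"]
      by (auto simp: v_def seq_space_def unit_disc_def)
    then obtain t where t: "t \<in> {0..1}" "\<And>j. schoenberg_coord j t = v j"
      using schoenberg_surj[of v] by blast
    have "c t k = x k" for k
      using t complex_polar_e_unit[of "x k"] by (simp add: c_def cl_def v_def)
    then show "x \<in> c ` {0..1}" using t by (intro image_eqI[of _ _ t]) auto
  qed
  show "range c = seq_space" "c ` {0..1} = seq_space" using sub sup by auto
qed

lemma compact_seq_space: "compact seq_space"
  by (rule seq_space_curve) (metis compact_continuous_image compact_Icc continuous_on_subset subset_UNIV)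

lemma continuous_seq_space_bounded:
  fixes F :: "(int \<Rightarrow> complex) \<Rightarrow> complex"
  assumes "continuous_on seq_space F"
  obtains B where "\<And>x. x \<in> seq_space \<Longrightarrow> norm (F x) \<le> B"
  using compact_imp_bounded[OF compact_continuous_image[OF assms compact_seq_space]]
  by (auto simp: bounded_iff)

text \<open>Lifts of the points \<open>y n\<close> lie in \<open>{0..1}\<close>, so their empirical
  measures on the line are tight. Along the curve every continuous \<open>F\<close> on the compact
  sequence space becomes bounded and continuous on the line, hence weak convergence there transports
  to the image of the limit measure under \<open>c\<close>.\<close>

lemma weak_limit_along_subsequence:
  fixes y :: "nat \<Rightarrow> int \<Rightarrow> complex" and s :: "nat \<Rightarrow> nat"
  assumes y: "\<And>n. y n \<in> seq_space" and s: "\<And>k. s k > 0"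
  obtains r \<mu> where "strict_mono (r :: nat \<Rightarrow> nat)" "prob_space \<mu>"
    "sets \<mu> = sets (restrict_space borel seq_space)"
    "\<And>F. continuous_on seq_space F \<Longrightarrow> (\<lambda>k. cesaro (\<lambda>m. F (y m)) (s (r k))) \<longlonglongrightarrow> (\<integral>x. F x \<partial>\<mu>)"
proof -
  obtain c :: "real \<Rightarrow> int \<Rightarrow> complex"
    where c: "continuous_on UNIV c" "range c = seq_space" "c ` {0..1} = seq_space"
    by (rule seq_space_curve)
  have "\<exists>t\<in>{0..1}. c t = y n" for n using y c(3) by (metis imageE)
  then obtain t where t: "\<And>n. t n \<in> {0..1}" "\<And>n. c (t n) = y n" by metis
  define \<nu> where "\<nu> k = distr (measure_pmf (pmf_of_set {1..s k})) borel t" for k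
  have \<nu>: "real_distribution (\<nu> k)" for k
    unfolding \<nu>_def by (rule prob_space.real_distribution_distr[OF prob_space_measure_pmf]) simp
  have int: "integral\<^sup>L (\<nu> k) f = cesaro (\<lambda>m. f (t m)) (s k)" if "f \<in> borel_measurable borel"
    for k and f :: "real \<Rightarrow> complex"
  proof -
    have "integral\<^sup>L (\<nu> k) f = (\<integral>m. f (t m) \<partial>measure_pmf (pmf_of_set {1..s k}))"
      unfolding \<nu>_def by (rule integral_distr) (use that in auto)
    also have "\<dots> = (\<Sum>m=1..s k. (1 / real (s k)) *\<^sub>R f (t m))"
      by (subst integral_measure_pmf[of "{1..s k}"]) (use s[of k] in auto)
    also have "\<dots> = cesaro (\<lambda>m. f (t m)) (s k)"
      by (simp add: cesaro_def sum_divide_distrib scaleR_conv_of_real)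
    finally show ?thesis .
  qed
  have mass: "1 - e < measure (\<nu> k) {-1<..2}" if "e > 0" for e :: real and k
  proof -
    interpret real_distribution "\<nu> k" by (rule \<nu>)
    have "AE x in measure_pmf (pmf_of_set {1..s k}). t x \<in> {-1<..2}"
      using t(1) by (intro AE_I2) (smt (verit) atLeastAtMost_iff greaterThanAtMost_iff)
    then have "AE x in \<nu> k. x \<in> {-1<..2}"
      unfolding \<nu>_def by (subst AE_distr_iff) auto
    then have "measure (\<nu> k) {-1<..2} = 1" by (subst prob_eq_1) auto
    then show ?thesis using that by simp
  qed
  have "tight \<nu>"
    unfolding tight_def
  proof (intro conjI allI impI \<nu>)
    fix e :: real assume "e > 0"
    then show "\<exists>a b. a < b \<and> (\<forall>k. 1 - e < measure (\<nu> k) {a<..b})"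
      using mass by (intro exI[of _ "-1"] exI[of _ 2]) simp
  qed
  then obtain r M where r: "strict_mono r" and M: "real_distribution M" "weak_conv_m (\<nu> \<circ> id \<circ> r) M"
    using tight_imp_convergent_subsubsequence[OF _ strict_mono_id] by blast
  interpret M: real_distribution M by fact
  have cm: "c \<in> measurable M (restrict_space borel seq_space)"
  proof (rule measurable_restrict_space2)
    show "c \<in> borel_measurable M"
      by (rule M.measurable_finite_borel, rule borel_measurable_continuous_onI, rule c)
  qed (use c in auto)
  define \<mu> where "\<mu> = distr M (restrict_space borel seq_space) c"
  show thesis
  proof (rule that[OF r])
    show "prob_space \<mu>" unfolding \<mu>_def by (rule M.prob_space_distr[OF cm])
    show "sets \<mu> = sets (restrict_space borel seq_space)" by (simp add: \<mu>_def)
    fix F :: "(int \<Rightarrow> complex) \<Rightarrow> complex" assume F: "continuous_on seq_space F"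
    obtain B where B: "\<And>x. x \<in> seq_space \<Longrightarrow> norm (F x) \<le> B"
      using continuous_seq_space_bounded[OF F] by blast
    have Fc: "continuous_on UNIV (\<lambda>t. F (c t))"
      by (rule continuous_on_compose2[OF F c(1)]) (use c in auto)
    have "(\<lambda>k. integral\<^sup>L ((\<nu> \<circ> id \<circ> r) k) (\<lambda>t. F (c t))) \<longlonglongrightarrow> integral\<^sup>L M (\<lambda>t. F (c t))"
    proof (rule weak_conv_imp_integral_bdd_continuous_conv[OF _ M])
      show "norm (F (c t)) \<le> B" for t using B c(2) by blast
      show "isCont (\<lambda>t. F (c t)) t" for t using Fc by (simp add: continuous_on_eq_continuous_at)
    qed (simp add: \<nu>)
    moreover have "integral\<^sup>L M (\<lambda>t. F (c t)) = (\<integral>x. F x \<partial>\<mu>)"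
      unfolding \<mu>_def
      by (rule integral_distr[symmetric, OF cm]) (rule borel_measurable_continuous_on_restrict[OF F])
    moreover have "integral\<^sup>L ((\<nu> \<circ> id \<circ> r) k) (\<lambda>t. F (c t)) = cesaro (\<lambda>m. F (y m)) (s (r k))" for k
      using int[OF borel_measurable_continuous_onI[OF Fc]] by (simp add: t)
    ultimately show "(\<lambda>k. cesaro (\<lambda>m. F (y m)) (s (r k))) \<longlonglongrightarrow> (\<integral>x. F x \<partial>\<mu>)" by simp
  qed
qed

section \<open>The ergodic theorem for continuous functions\<close>

lemma funpow_seq_shift: "(seq_shift ^^ m) x = (\<lambda>n. x (n + int m))"
  by (induction m) (auto simp: seq_shift_def algebra_simps)

lemma funpow_seq_shift_in [simp]: "x \<in> seq_space \<Longrightarrow> (seq_shift ^^ m) x \<in> seq_space"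
  by (simp add: funpow_seq_shift seq_space_def)

lemma seq_shift_in [simp]: "x \<in> seq_space \<Longrightarrow> seq_shift x \<in> seq_space"
  by (simp add: seq_shift_def seq_space_def)

lemma continuous_funpow_seq_shift: "continuous_on S (seq_shift ^^ m)"
proof (rule continuous_on_coordinatewise_then_product)
  show "continuous_on S (\<lambda>x. (seq_shift ^^ m) x n)" for n
    unfolding funpow_seq_shift by (rule continuous_on_subset[OF continuous_on_product_coordinates]) simp
qed

lemma continuous_compose_funpow_shift:
  "continuous_on seq_space F \<Longrightarrow> continuous_on seq_space (\<lambda>x. F ((seq_shift ^^ m) x))"
  by (rule continuous_on_compose2[OF _ continuous_funpow_seq_shift]) auto

lemma continuous_compose_shift:
  "continuous_on seq_space F \<Longrightarrow> continuous_on seq_space (\<lambda>x. F (seq_shift x))"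
  using continuous_compose_funpow_shift[of F 1] by simp

definition birkhoff_sum :: "((int \<Rightarrow> complex) \<Rightarrow> 'b::comm_monoid_add) \<Rightarrow> nat \<Rightarrow> (int \<Rightarrow> complex) \<Rightarrow> 'b" where
  "birkhoff_sum F n x = (\<Sum>i<n. F ((seq_shift ^^ i) x))"

lemma birkhoff_sum_Suc: "birkhoff_sum F (Suc n) x = F x + birkhoff_sum F n (seq_shift x)"
  unfolding birkhoff_sum_def
  by (subst sum.lessThan_Suc_shift) (simp add: funpow_swap1)

lemma continuous_birkhoff_sum:
  fixes F :: "(int \<Rightarrow> complex) \<Rightarrow> 'b::real_normed_vector"
  shows "continuous_on seq_space F \<Longrightarrow> continuous_on seq_space (birkhoff_sum F n)"
  unfolding birkhoff_sum_def[abs_def] by (intro continuous_intros continuous_compose_funpow_shift)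

text \<open>\<open>birkhoff_max G n\<close> is the maximum of the first \<open>n\<close> Birkhoff sums (the empty one included), in the
  recursive form that the maximal inequality needs.\<close>

primrec birkhoff_max :: "((int \<Rightarrow> complex) \<Rightarrow> real) \<Rightarrow> nat \<Rightarrow> (int \<Rightarrow> complex) \<Rightarrow> real" where
  "birkhoff_max G 0 x = 0"
| "birkhoff_max G (Suc n) x = max 0 (G x + birkhoff_max G n (seq_shift x))"

lemma birkhoff_max_nonneg: "birkhoff_max G n x \<ge> 0"
  by (cases n) auto

lemma birkhoff_max_Suc: "birkhoff_max G n x \<le> birkhoff_max G (Suc n) x"
proof (induction n arbitrary: x)
  case (Suc n)
  show ?case using Suc[of "seq_shift x"] by (simp del: birkhoff_max.simps(2) add: birkhoff_max.simps(2)[of _ _ x])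
qed simp

lemma birkhoff_sum_le_max: "k \<le> n \<Longrightarrow> birkhoff_sum G k x \<le> birkhoff_max G n x"
proof (induction n arbitrary: k x)
  case 0
  then show ?case by (simp add: birkhoff_sum_def)
next
  case (Suc n)
  show ?case
  proof (cases k)
    case (Suc j)
    then show ?thesis using Suc.IH[of j "seq_shift x"] Suc.prems by (simp add: birkhoff_sum_Suc)
  qed (simp add: birkhoff_sum_def)
qed

lemma continuous_birkhoff_max:
  "continuous_on seq_space G \<Longrightarrow> continuous_on seq_space (birkhoff_max G n)"
proof (induction n)
  case (Suc n)
  then show ?case unfolding birkhoff_max.simps by (intro continuous_intros continuous_compose_shift) auto
qed (simp add: birkhoff_max.simps[abs_def])

text \<open>Invariance is expressed by integrals of continuous functions, the form in which weak
  limits provide it; the maximal functions to which it is applied are continuous.\<close>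

locale shift_invariant_measure = prob_space \<mu> for \<mu> :: "(int \<Rightarrow> complex) measure" +
  assumes sets_mu: "sets \<mu> = sets (restrict_space borel seq_space)"
    and integral_shift: "\<And>F :: (int \<Rightarrow> complex) \<Rightarrow> complex. continuous_on seq_space F \<Longrightarrow>
          (\<integral>x. F (seq_shift x) \<partial>\<mu>) = (\<integral>x. F x \<partial>\<mu>)"
begin

lemma space_mu: "space \<mu> = seq_space"
  using sets_eq_imp_space_eq[OF sets_mu] by (simp add: space_restrict_space)

lemma measurable_continuous:
  fixes F :: "(int \<Rightarrow> complex) \<Rightarrow> 'b::topological_space"
  shows "continuous_on seq_space F \<Longrightarrow> F \<in> borel_measurable \<mu>"
  using borel_measurable_continuous_on_restrict[of seq_space F]
  by (simp add: measurable_cong_sets[OF sets_mu refl])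

lemma integrable_continuous:
  fixes F :: "(int \<Rightarrow> complex) \<Rightarrow> 'b::{banach, second_countable_topology}"
  assumes "continuous_on seq_space F"
  shows "integrable \<mu> F"
proof -
  obtain B where "\<And>x. x \<in> seq_space \<Longrightarrow> norm (F x) \<le> B"
    using compact_imp_bounded[OF compact_continuous_image[OF assms compact_seq_space]]
    by (auto simp: bounded_iff)
  then show ?thesis
    by (intro integrable_const_bound[of F B] AE_I2 measurable_continuous assms) (simp add: space_mu)
qed

lemma integral_shift_real:
  fixes F :: "(int \<Rightarrow> complex) \<Rightarrow> real"
  assumes "continuous_on seq_space F"
  shows "(\<integral>x. F (seq_shift x) \<partial>\<mu>) = (\<integral>x. F x \<partial>\<mu>)"
proof -
  have "complex_of_real (\<integral>x. F (seq_shift x) \<partial>\<mu>) = of_real (\<integral>x. F x \<partial>\<mu>)"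
    using integral_shift[of "\<lambda>x. of_real (F x)"] assms
    by (simp add: continuous_intros)
  then show ?thesis by (simp only: of_real_eq_iff)
qed

text \<open>Garsia's argument: on the invariant set where the sums are unbounded, \<open>D n\<close> below tends to \<open>G\<close> and has nonnegative integral.\<close>

lemma AE_birkhoff_sum_bounded_above:
  fixes G :: "(int \<Rightarrow> complex) \<Rightarrow> real"
  assumes erg: "ergodic_system \<mu> seq_shift" and G: "continuous_on seq_space G"
    and neg: "(\<integral>x. G x \<partial>\<mu>) < 0"
  shows "AE x in \<mu>. \<exists>K. \<forall>n. birkhoff_sum G n x \<le> K"
proof -
  \<comment> \<open>Natural thresholds keep the conditions countable, hence the set measurable. It
    is invariant because the sums at \<open>x\<close> and at its shift differ by the fixed amount
    \<open>G x\<close>.\<close>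
  define E where "E = {x \<in> space \<mu>. \<forall>k::nat. \<exists>n. birkhoff_sum G n x > real k}"
  have [measurable]: "birkhoff_sum G n \<in> borel_measurable \<mu>" for n
    by (intro measurable_continuous continuous_birkhoff_sum G)
  have E: "E \<in> sets \<mu>" unfolding E_def by measurable
  have shift_iff: "seq_shift x \<in> E \<longleftrightarrow> x \<in> E" if "x \<in> seq_space" for x
  proof -
    have "(\<forall>k::nat. \<exists>n. birkhoff_sum G n (seq_shift x) > real k) \<longleftrightarrow>
          (\<forall>k::nat. \<exists>n. birkhoff_sum G n x > real k)"
    proof safe
      fix k :: nat assume *: "\<forall>k::nat. \<exists>n. birkhoff_sum G n (seq_shift x) > real k"
      obtain k' :: nat where "real k' \<ge> real k - G x" using real_arch_simple by blast
      moreover obtain n where "birkhoff_sum G n (seq_shift x) > real k'" using * by blast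
      ultimately show "\<exists>n. birkhoff_sum G n x > real k"
        by (intro exI[of _ "Suc n"]) (simp add: birkhoff_sum_Suc)
    next
      fix k :: nat assume *: "\<forall>k::nat. \<exists>n. birkhoff_sum G n x > real k"
      obtain k' :: nat where k': "real k' \<ge> real k + G x" using real_arch_simple by blast
      obtain n where n: "birkhoff_sum G n x > real k'" using * by blast
      then obtain m where "n = Suc m" by (cases n) (auto simp: birkhoff_sum_def)
      with n k' show "\<exists>n. birkhoff_sum G n (seq_shift x) > real k"
        by (intro exI[of _ m]) (simp add: birkhoff_sum_Suc)
    qed
    then show ?thesis using that by (simp add: E_def space_mu)
  qed
  have "seq_shift -` E \<inter> space \<mu> = E"
    using shift_iff by (auto simp: space_mu) (auto simp: E_def space_mu)
  then have "prob E = 0 \<or> prob E = 1" using erg E by (simp add: ergodic_system_def)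
  moreover have "prob E \<noteq> 1"
  proof
    assume "prob E = 1"
    then have AE_E: "AE x in \<mu>. x \<in> E" using E by (simp add: prob_eq_1)
    define D where "D n x = birkhoff_max G (Suc n) x - birkhoff_max G n (seq_shift x)" for n x
    have D: "D n x = max (- birkhoff_max G n (seq_shift x)) (G x)" for n x
      by (auto simp: D_def max_def)
    have cM: "continuous_on seq_space (birkhoff_max G n)"
      and cMs: "continuous_on seq_space (\<lambda>x. birkhoff_max G n (seq_shift x))" for n
      by (intro continuous_compose_shift continuous_birkhoff_max G)+
    have "(\<lambda>n. \<integral>x. D n x \<partial>\<mu>) \<longlonglongrightarrow> (\<integral>x. G x \<partial>\<mu>)"
    proof (rule integral_dominated_convergence[where w = "\<lambda>x. \<bar>G x\<bar>"])
      show "integrable \<mu> (\<lambda>x. \<bar>G x\<bar>)" by (intro integrable_continuous continuous_intros G)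
      show "G \<in> borel_measurable \<mu>" by (intro measurable_continuous G)
      \<comment> \<open>For the domination that follows: maxima of Birkhoff sums are nonnegative, so
        \<open>D n x\<close> lies between \<open>G x\<close> and \<open>max 0 (G x)\<close>.\<close>
      show "D n \<in> borel_measurable \<mu>" for n
        unfolding D_def[abs_def] by (intro measurable_continuous continuous_intros cM cMs)
      show "AE x in \<mu>. norm (D n x) \<le> \<bar>G x\<bar>" for n
        using birkhoff_max_nonneg[of G n] by (intro AE_I2) (smt (verit) D real_norm_def)
      show "AE x in \<mu>. (\<lambda>n. D n x) \<longlonglongrightarrow> G x"
        using AE_E
      proof eventually_elim
        case (elim x)
        then have x: "x \<in> seq_space" by (simp add: E_def space_mu)
        obtain k :: nat where k: "real k \<ge> - G x" using real_arch_simple by blast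
        obtain m where m: "birkhoff_sum G m (seq_shift x) > real k"
          using elim shift_iff[OF x] by (auto simp: E_def)
        have "\<forall>\<^sub>F n in sequentially. D n x = G x"
        proof (rule eventually_sequentiallyI[of m])
          fix n assume "m \<le> n"
          from birkhoff_sum_le_max[OF this, of G "seq_shift x"] m k
          show "D n x = G x" by (simp add: D max_def)
        qed
        then show ?case by (rule tendsto_eventually)
      qed
    qed
    \<comment> \<open>Invariance removes the shift from the second maximal function, and the maxima
      increase with \<open>n\<close>.\<close>
    moreover have "0 \<le> (\<integral>x. D n x \<partial>\<mu>)" for n
    proof -
      have "(\<integral>x. D n x \<partial>\<mu>) = (\<integral>x. birkhoff_max G (Suc n) x \<partial>\<mu>) - (\<integral>x. birkhoff_max G n (seq_shift x) \<partial>\<mu>)"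
        unfolding D_def by (intro Bochner_Integration.integral_diff integrable_continuous cM cMs)
      also have "(\<integral>x. birkhoff_max G n (seq_shift x) \<partial>\<mu>) = (\<integral>x. birkhoff_max G n x \<partial>\<mu>)"
        by (rule integral_shift_real[OF cM])
      finally have "(\<integral>x. D n x \<partial>\<mu>) = (\<integral>x. birkhoff_max G (Suc n) x \<partial>\<mu>) - (\<integral>x. birkhoff_max G n x \<partial>\<mu>)" .
      moreover have "(\<integral>x. birkhoff_max G n x \<partial>\<mu>) \<le> (\<integral>x. birkhoff_max G (Suc n) x \<partial>\<mu>)"
        by (intro integral_mono integrable_continuous cM birkhoff_max_Suc)
      ultimately show ?thesis by simp
    qed
    ultimately have "0 \<le> (\<integral>x. G x \<partial>\<mu>)" by (intro LIMSEQ_le_const) auto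
    with neg show False by simp
  qed
  ultimately have "prob E = 0" by blast
  then have "AE x in \<mu>. x \<notin> E" using E by (simp add: prob_eq_0)
  then show ?thesis
  proof (rule AE_mp, intro AE_I2 impI)
    fix x assume "x \<in> space \<mu>" "x \<notin> E"
    then show "\<exists>K. \<forall>n. birkhoff_sum G n x \<le> K" by (auto simp: E_def not_less)
  qed
qed

text \<open>After subtracting slightly more than its mean, \<open>F\<close> has negative integral,
  so its Birkhoff sums are bounded above and vanish in the limit after division by \<open>n\<close>.
  The excess runs through \<open>1 / Suc j\<close>, which leaves countably many null sets.\<close>

lemma AE_birkhoff_average_le:
  fixes F :: "(int \<Rightarrow> complex) \<Rightarrow> real"
  assumes erg: "ergodic_system \<mu> seq_shift" and F: "continuous_on seq_space F"
  shows "AE x in \<mu>. \<forall>e>0. \<forall>\<^sub>F n in sequentially. birkhoff_sum F n x / n < (\<integral>x. F x \<partial>\<mu>) + e"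
proof -
  define I where "I = (\<integral>x. F x \<partial>\<mu>)"
  have "AE x in \<mu>. \<exists>K. \<forall>n. birkhoff_sum (\<lambda>x. F x - (I + 1 / real (Suc j))) n x \<le> K" for j
  proof (rule AE_birkhoff_sum_bounded_above[OF erg])
    show "continuous_on seq_space (\<lambda>x. F x - (I + 1 / real (Suc j)))" by (intro continuous_intros F)
    have "(\<integral>x. F x - (I + 1 / real (Suc j)) \<partial>\<mu>) = I - (I + 1 / real (Suc j))"
      using integrable_continuous[OF F] by (simp add: I_def prob_space)
    then show "(\<integral>x. F x - (I + 1 / real (Suc j)) \<partial>\<mu>) < 0" by simp
  qed
  then have "AE x in \<mu>. \<forall>j. \<exists>K. \<forall>n. birkhoff_sum (\<lambda>x. F x - (I + 1 / real (Suc j))) n x \<le> K"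
    by (simp add: AE_all_countable)
  then show ?thesis
  proof eventually_elim
    case (elim x)
    show ?case
    proof (intro allI impI)
      fix e :: real assume "e > 0"
      then obtain j where j: "1 / real (Suc j) < e / 2" using nat_approx_posE[of "e/2"] by auto
      obtain K where K: "\<And>n. birkhoff_sum (\<lambda>x. F x - (I + 1 / real (Suc j))) n x \<le> K" using elim by blast
      have "(\<lambda>n. K / real n) \<longlonglongrightarrow> 0" by (rule lim_const_over_n)
      then have "\<forall>\<^sub>F n in sequentially. K / real n < e / 2" using \<open>e > 0\<close> by (intro order_tendstoD) auto
      with eventually_gt_at_top[of 0]
      show "\<forall>\<^sub>F n in sequentially. birkhoff_sum F n x / n < (\<integral>x. F x \<partial>\<mu>) + e"
      proof eventually_elim
        case (elim n)
        have "birkhoff_sum F n x - n * (I + 1 / real (Suc j)) \<le> K"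
          using K[of n] by (simp add: birkhoff_sum_def sum_subtractf)
        then have "birkhoff_sum F n x / n - (I + 1 / real (Suc j)) \<le> K / n"
          using elim divide_right_mono[of _ K "real n"] by (fastforce simp: diff_divide_distrib)
        then show ?case using elim j unfolding I_def by linarith
      qed
    qed
  qed
qed

lemma AE_birkhoff_average_tendsto:
  fixes F :: "(int \<Rightarrow> complex) \<Rightarrow> real"
  assumes erg: "ergodic_system \<mu> seq_shift" and F: "continuous_on seq_space F"
  shows "AE x in \<mu>. (\<lambda>n. birkhoff_sum F n x / n) \<longlonglongrightarrow> (\<integral>x. F x \<partial>\<mu>)"
proof -
  have "continuous_on seq_space (\<lambda>x. - F x)" by (intro continuous_intros F)
  from AE_birkhoff_average_le[OF erg F] AE_birkhoff_average_le[OF erg this]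
  show ?thesis
  proof eventually_elim
    case (elim x)
    have neg: "birkhoff_sum (\<lambda>x. - F x) n x = - birkhoff_sum F n x" for n
      by (simp add: birkhoff_sum_def sum_negf)
    show ?case
    proof (rule tendstoI)
      fix e :: real assume "e > 0"
      then have "\<forall>\<^sub>F n in sequentially. birkhoff_sum F n x / n < (\<integral>x. F x \<partial>\<mu>) + e"
        and "\<forall>\<^sub>F n in sequentially. - birkhoff_sum F n x / n < - (\<integral>x. F x \<partial>\<mu>) + e"
        using elim by (simp_all add: neg)
      then show "\<forall>\<^sub>F n in sequentially. dist (birkhoff_sum F n x / n) (\<integral>x. F x \<partial>\<mu>) < e"
        by eventually_elim (simp add: dist_real_def abs_less_iff)
    qed
  qed
qed

text \<open>Dominated convergence applied to the pointwise theorem for real and imaginary parts. The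
  mean form is what can be transferred to \<open>w\<close>: for fixed \<open>n\<close> the integrand
  is continuous, so its integral is a limit of averages along the orbit, while a statement almost
  everywhere says nothing about that particular orbit.\<close>

lemma mean_ergodic:
  fixes F :: "(int \<Rightarrow> complex) \<Rightarrow> complex"
  assumes erg: "ergodic_system \<mu> seq_shift" and F: "continuous_on seq_space F"
  shows "(\<lambda>n. \<integral>x. norm (birkhoff_sum F n x / of_nat n - (\<integral>x. F x \<partial>\<mu>)) \<partial>\<mu>) \<longlonglongrightarrow> 0"
proof -
  define I where "I = (\<integral>x. F x \<partial>\<mu>)"
  obtain B where B: "\<And>x. x \<in> seq_space \<Longrightarrow> norm (F x) \<le> B"
    using continuous_seq_space_bounded[OF F] by blast
  have int: "integrable \<mu> F" by (rule integrable_continuous[OF F])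
  have "continuous_on seq_space (\<lambda>x. Re (F x))" "continuous_on seq_space (\<lambda>x. Im (F x))"
    by (intro continuous_intros F)+
  note this[THEN AE_birkhoff_average_tendsto[OF erg]]
  then have AE: "AE x in \<mu>. (\<lambda>n. birkhoff_sum F n x / of_nat n) \<longlonglongrightarrow> I"
  proof eventually_elim
    case (elim x)
    have "Re (birkhoff_sum F n x) = birkhoff_sum (\<lambda>x. Re (F x)) n x"
      "Im (birkhoff_sum F n x) = birkhoff_sum (\<lambda>x. Im (F x)) n x" for n
      by (simp_all add: birkhoff_sum_def)
    then show ?case
      using elim int by (simp add: tendsto_complex_iff I_def Re_divide_of_nat Im_divide_of_nat)
  qed
  have "(\<lambda>n. \<integral>x. norm (birkhoff_sum F n x / of_nat n - I) \<partial>\<mu>) \<longlonglongrightarrow> (\<integral>x. 0 \<partial>\<mu>)"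
  proof (rule integral_dominated_convergence[where w = "\<lambda>x. \<bar>B\<bar> + norm I"])
    show "AE x in \<mu>. (\<lambda>n. norm (birkhoff_sum F n x / of_nat n - I)) \<longlonglongrightarrow> 0"
      using AE by eventually_elim (simp add: tendsto_norm_zero_iff LIM_zero_iff)
    have "norm (birkhoff_sum F n x / of_nat n) \<le> \<bar>B\<bar>" if "x \<in> seq_space" for n x
    proof -
      have "norm (birkhoff_sum F n x) \<le> (\<Sum>i<n. \<bar>B\<bar>)"
        unfolding birkhoff_sum_def using B[OF funpow_seq_shift_in[OF that]]
        by (intro sum_norm_le) (meson abs_ge_self order_trans)
      then show ?thesis by (cases "n = 0") (auto simp: norm_divide field_simps)
    qed
    then show "AE x in \<mu>. norm (norm (birkhoff_sum F n x / of_nat n - I)) \<le> \<bar>B\<bar> + norm I" for n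
      by (intro AE_I2) (auto simp: space_mu intro!: norm_triangle_le_diff add_mono)
    show "(\<lambda>x. norm (birkhoff_sum F n x / of_nat n - I)) \<in> borel_measurable \<mu>" for n
      using measurable_continuous[OF continuous_birkhoff_sum[OF F, of n]] by measurable
  qed auto
  then show ?thesis by (simp add: I_def)
qed

end

section \<open>Averages along ergodic sequences\<close>

definition fdiff :: "(nat \<Rightarrow> real) \<Rightarrow> nat \<Rightarrow> real" where
  "fdiff f n = f (Suc n) - f n"

text \<open>The number \<open>d\<close> counts the van der Corput steps still to be made; at
  \<open>d = 0\<close> the three conditions are those of \<open>cesaro_e_unit_slow\<close>.\<close>

definition decaying_difference :: "nat \<Rightarrow> real \<Rightarrow> (nat \<Rightarrow> real) \<Rightarrow> bool" where
  "decaying_difference d \<kappa> f \<longleftrightarrow>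
     (fdiff ^^ Suc d) f \<longlonglongrightarrow> 0 \<and>
     (\<forall>\<^sub>F n in sequentially. (fdiff ^^ Suc d) f (Suc n) \<le> (fdiff ^^ Suc d) f n) \<and>
     (\<forall>\<^sub>F n in sequentially. \<kappa> \<le> n * (fdiff ^^ Suc d) f n)"

lemma funpow_fdiff_shift_diff:
  "(fdiff ^^ k) (\<lambda>n. f (n + h) - f n) = (\<lambda>n. (fdiff ^^ k) f (n + h) - (fdiff ^^ k) f n)"
  by (induction k) (auto simp: fdiff_def fun_eq_iff)

lemma funpow_fdiff_cmult: "(fdiff ^^ k) (\<lambda>n. c * f n) = (\<lambda>n. c * (fdiff ^^ k) f n)"
  by (induction k) (auto simp: fdiff_def fun_eq_iff algebra_simps)

lemma sum_fdiff: "(\<Sum>i<h. fdiff f (n + i)) = f (n + h) - f n"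
  by (induction h) (auto simp: fdiff_def)

lemma decaying_difference_mono:
  assumes "decaying_difference d \<kappa> f" "\<kappa>' \<le> \<kappa>"
  shows "decaying_difference d \<kappa>' f"
proof -
  have "\<forall>\<^sub>F n in sequentially. \<kappa> \<le> n * (fdiff ^^ Suc d) f n"
    using assms(1) by (simp only: decaying_difference_def)
  then have "\<forall>\<^sub>F n in sequentially. \<kappa>' \<le> n * (fdiff ^^ Suc d) f n"
    by eventually_elim (use assms(2) in linarith)
  then show ?thesis using assms(1) by (simp only: decaying_difference_def)
qed

lemma decaying_difference_cmult:
  assumes "decaying_difference d \<kappa> f" "c > 0"
  shows "decaying_difference d (c * \<kappa>) (\<lambda>n. c * f n)"
  using assms tendsto_mult_right_zero[of _ sequentially c]
  unfolding decaying_difference_def funpow_fdiff_cmult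
  by (auto elim!: eventually_mono simp: mult.left_commute)

text \<open>The relevant difference of \<open>f (n + h) - f n\<close> is a sum of \<open>h\<close>
  consecutive values of the difference of \<open>f\<close> of one order more. Each is at least
  \<open>\<kappa> / (n + i)\<close>, hence at least \<open>\<kappa> / (2 * n)\<close>, and the gain
  over \<open>\<kappa>\<close> is the factor \<open>h / 2\<close>.\<close>

lemma decaying_difference_shift_diff:
  assumes f: "decaying_difference (Suc d) \<kappa> f" and "\<kappa> > 0"
  shows "decaying_difference d (h * \<kappa> / 2) (\<lambda>n. f (n + h) - f n)"
proof -
  define g where "g = (fdiff ^^ Suc (Suc d)) f"
  have g: "g \<longlonglongrightarrow> 0" "\<forall>\<^sub>F n in sequentially. g (Suc n) \<le> g n" "\<forall>\<^sub>F n in sequentially. \<kappa> \<le> n * g n"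
    using f by (simp_all only: decaying_difference_def g_def)
  have eq: "(fdiff ^^ Suc d) (\<lambda>n. f (n + h) - f n) = (\<lambda>n. \<Sum>i<h. g (n + i))"
    using sum_fdiff[of "(fdiff ^^ Suc d) f" _ h] unfolding funpow_fdiff_shift_diff g_def by simp
  have "(\<lambda>n. \<Sum>i<h. g (n + i)) \<longlonglongrightarrow> (\<Sum>i<h. 0)"
    by (intro tendsto_sum LIMSEQ_ignore_initial_segment g)
  moreover have "\<forall>\<^sub>F n in sequentially. (\<Sum>i<h. g (Suc n + i)) \<le> (\<Sum>i<h. g (n + i))"
  proof -
    obtain m where "\<And>n. n \<ge> m \<Longrightarrow> g (Suc n) \<le> g n" using g(2) by (auto simp: eventually_sequentially)
    then show ?thesis by (intro eventually_sequentiallyI[of m] sum_mono) simp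
  qed
  moreover have "\<forall>\<^sub>F n in sequentially. h * \<kappa> / 2 \<le> n * (\<Sum>i<h. g (n + i))"
  proof -
    obtain m where m: "\<And>n. n \<ge> m \<Longrightarrow> \<kappa> \<le> n * g n" using g(3) by (auto simp: eventually_sequentially)
    show ?thesis
    \<comment> \<open>The bound \<open>n \<ge> h\<close> gives \<open>n + i \<le> 2 * n\<close> for
      all \<open>i < h\<close>.\<close>
    proof (rule eventually_sequentiallyI[of "max m h"])
      fix n assume n: "max m h \<le> n"
      have "(\<Sum>i<h. \<kappa> / 2) \<le> (\<Sum>i<h. n * g (n + i))"
      proof (rule sum_mono)
        fix i assume "i \<in> {..<h}"
        then have i: "i \<le> n" using n by auto
        have k: "\<kappa> \<le> real (n + i) * g (n + i)" using m[of "n + i"] n by simp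
        then have "0 < real (n + i) * g (n + i)" using \<open>\<kappa> > 0\<close> by linarith
        then have "g (n + i) > 0" by (simp only: zero_less_mult_iff) auto
        then have "real (n + i) * g (n + i) \<le> (2 * real n) * g (n + i)"
          using i by (intro mult_right_mono) auto
        with k show "\<kappa> / 2 \<le> n * g (n + i)" by simp
      qed
      then show "h * \<kappa> / 2 \<le> n * (\<Sum>i<h. g (n + i))" by (simp add: sum_distrib_left)
    qed
  qed
  ultimately show ?thesis unfolding decaying_difference_def eq by simp
qed

lemma e_unit_slow_variation:
  assumes "fdiff f \<longlonglongrightarrow> 0"
  shows "(\<lambda>n. e_unit (f n) - e_unit (f (n + h))) \<longlonglongrightarrow> 0"
proof -
  have "(\<lambda>n. \<Sum>i<h. fdiff f (n + i)) \<longlonglongrightarrow> (\<Sum>i<h. 0)"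
    by (intro tendsto_sum LIMSEQ_ignore_initial_segment assms)
  then have "(\<lambda>n. f (n + h) - f n) \<longlonglongrightarrow> 0" by (simp add: sum_fdiff)
  then have "(\<lambda>n. e_unit (f (n + h) - f n)) \<longlonglongrightarrow> e_unit 0"
    by (rule isCont_tendsto_compose[OF isCont_e_unit])
  then have "(\<lambda>n. norm (1 - e_unit (f (n + h) - f n))) \<longlonglongrightarrow> norm (1 - e_unit 0)"
    by (intro tendsto_intros)
  moreover have "norm (1 - e_unit (f (n + h) - f n)) = norm (e_unit (f n) - e_unit (f (n + h)))" for n
  proof -
    have "e_unit (f n) - e_unit (f (n + h)) = e_unit (f n) * (1 - e_unit (f (n + h) - f n))"
      by (simp add: algebra_simps flip: e_unit_add)
    then show ?thesis by (simp add: norm_mult)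
  qed
  ultimately show ?thesis using tendsto_norm_zero_iff by fastforce
qed

section \<open>Induction on the number of van der Corput steps\<close>

locale ergodic_sequence =
  fixes w :: "nat \<Rightarrow> complex"
  assumes in_disc: "n \<ge> 1 \<Longrightarrow> w n \<in> unit_disc" and ergodic: "ergodic_seq w"
begin

definition orb :: "nat \<Rightarrow> int \<Rightarrow> complex" where
  "orb n = (seq_shift ^^ n) (extend_seq w)"

lemma orb_in [simp]: "orb n \<in> seq_space"
  unfolding orb_def
  by (rule funpow_seq_shift_in) (use in_disc in \<open>auto simp: seq_space_def extend_seq_def unit_disc_def\<close>)

lemma orb_add: "orb (n + h) = (seq_shift ^^ h) (orb n)"
  by (simp add: orb_def funpow_seq_shift algebra_simps)

lemma orb_0: "n \<ge> 1 \<Longrightarrow> orb n 0 = w n"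
  by (simp add: orb_def funpow_seq_shift extend_seq_def)

text \<open>The limit along a refined subsequence is a Furstenberg measure, so the hypothesis on
  \<open>w\<close> makes it ergodic. It is invariant because shifting an average by one step changes
  it by boundary terms only.\<close>

lemma Furstenberg_limit:
  fixes s :: "nat \<Rightarrow> nat"
  assumes s: "strict_mono s" "\<And>k. s k > 0"
  obtains r \<mu> where "strict_mono (r :: nat \<Rightarrow> nat)" "shift_invariant_measure \<mu>" "ergodic_system \<mu> seq_shift"
    "\<And>F. continuous_on seq_space F \<Longrightarrow> (\<lambda>k. cesaro (\<lambda>m. F (orb m)) (s (r k))) \<longlonglongrightarrow> (\<integral>x. F x \<partial>\<mu>)"
proof -
  obtain r \<mu> where r: "strict_mono (r :: nat \<Rightarrow> nat)" and \<mu>: "prob_space \<mu>"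
    "sets \<mu> = sets (restrict_space borel seq_space)"
    and lim: "\<And>F. continuous_on seq_space F \<Longrightarrow> (\<lambda>k. cesaro (\<lambda>m. F (orb m)) (s (r k))) \<longlonglongrightarrow> (\<integral>x. F x \<partial>\<mu>)"
    using weak_limit_along_subsequence[of orb s, OF orb_in s(2)] by blast
  have sr: "strict_mono (\<lambda>k. s (r k))" using strict_mono_o[OF s(1) r] by (simp add: o_def)
  have "Furstenberg_measure w \<mu>"
    unfolding Furstenberg_measure_def
    using \<mu> lim sr s(2) by (intro conjI exI[of _ "\<lambda>k. s (r k)"]) (auto simp: cesaro_def orb_def)
  then have erg: "ergodic_system \<mu> seq_shift" using ergodic by (simp add: ergodic_seq_def)
  interpret prob_space \<mu> by fact
  have "shift_invariant_measure \<mu>"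
  proof
    fix F :: "(int \<Rightarrow> complex) \<Rightarrow> complex" assume F: "continuous_on seq_space F"
    obtain B where B: "\<And>x. x \<in> seq_space \<Longrightarrow> norm (F x) \<le> B"
      using continuous_seq_space_bounded[OF F] by blast
    have "(\<lambda>N. cesaro (\<lambda>m. F (orb (m + 1))) N - cesaro (\<lambda>m. F (orb m)) N) \<longlonglongrightarrow> 0"
      by (rule cesaro_shift[of _ B]) (simp add: B)
    from LIMSEQ_subseq_LIMSEQ[OF this sr]
    have "(\<lambda>k. cesaro (\<lambda>m. F (orb (m + 1))) (s (r k)) - cesaro (\<lambda>m. F (orb m)) (s (r k))) \<longlonglongrightarrow> 0"
      by (simp add: o_def)
    from tendsto_add[OF this lim[OF F]]
    have "(\<lambda>k. cesaro (\<lambda>m. F (orb (m + 1))) (s (r k))) \<longlonglongrightarrow> (\<integral>x. F x \<partial>\<mu>)" by simp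
    moreover have "(\<lambda>k. cesaro (\<lambda>m. F (orb (m + 1))) (s (r k))) \<longlonglongrightarrow> (\<integral>x. F (seq_shift x) \<partial>\<mu>)"
      using lim[OF continuous_compose_shift[OF F]] by (simp only: orb_add) simp
    ultimately show "(\<integral>x. F (seq_shift x) \<partial>\<mu>) = (\<integral>x. F x \<partial>\<mu>)" using LIMSEQ_unique by blast
  qed (rule \<mu>)
  then show thesis using that r erg lim by blast
qed

text \<open>For each fixed \<open>h\<close> the phase at \<open>n\<close> may be exchanged for the
  phase at \<open>n + h\<close>, after which the whole summand is a shift of \<open>U\<close>. Both
  errors vanish as \<open>N\<close> grows, and only the \<open>H\<close> shifts below
  \<open>H\<close> occur.\<close>

lemma cesaro_slow_birkhoff:
  assumes f: "fdiff f \<longlonglongrightarrow> 0" and F: "continuous_on seq_space F" "\<And>x. x \<in> seq_space \<Longrightarrow> norm (F x) \<le> 1"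
    and "H > 0"
  shows "(\<lambda>N. cesaro (\<lambda>n. e_unit (f n) * (birkhoff_sum F H (orb n) / of_nat H)) N
            - cesaro (\<lambda>n. e_unit (f n) * F (orb n)) N) \<longlonglongrightarrow> 0"
proof -
  define U where "U n = e_unit (f n) * F (orb n)" for n
  have one: "(\<lambda>N. cesaro (\<lambda>n. e_unit (f n) * F (orb (n + h))) N - cesaro U N) \<longlonglongrightarrow> 0" for h
  proof -
    have "(\<lambda>n. e_unit (f n) * F (orb (n + h)) - U (n + h)) \<longlonglongrightarrow> 0"
    proof (rule Lim_null_comparison)
      show "\<forall>\<^sub>F n in sequentially. norm (e_unit (f n) * F (orb (n + h)) - U (n + h))
            \<le> norm (e_unit (f n) - e_unit (f (n + h)))"
        using F(2)[OF orb_in]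
        by (intro always_eventually allI) (simp add: U_def norm_mult mult_left_le flip: left_diff_distrib)
      show "(\<lambda>n. norm (e_unit (f n) - e_unit (f (n + h)))) \<longlonglongrightarrow> 0"
        using e_unit_slow_variation[OF f] by (rule tendsto_norm_zero)
    qed
    then have "cesaro (\<lambda>n. e_unit (f n) * F (orb (n + h)) - U (n + h)) \<longlonglongrightarrow> 0"
      by (rule cesaro_tendsto_0)
    moreover have "(\<lambda>N. cesaro (\<lambda>n. U (n + h)) N - cesaro U N) \<longlonglongrightarrow> 0"
      by (rule cesaro_shift[of _ 1]) (simp add: U_def norm_mult F)
    ultimately have "(\<lambda>N. cesaro (\<lambda>n. e_unit (f n) * F (orb (n + h)) - U (n + h)) N
        + (cesaro (\<lambda>n. U (n + h)) N - cesaro U N)) \<longlonglongrightarrow> 0 + 0"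
      by (rule tendsto_add)
    then show ?thesis by (simp add: cesaro_diff)
  qed
  have "(\<lambda>N. (1 / of_nat H) * (\<Sum>h<H. cesaro (\<lambda>n. e_unit (f n) * F (orb (n + h))) N - cesaro U N))
      \<longlonglongrightarrow> (1 / of_nat H) * (\<Sum>h<H. 0)"
    by (intro tendsto_intros one)
  moreover have "(1 / of_nat H) * (\<Sum>h<H. cesaro (\<lambda>n. e_unit (f n) * F (orb (n + h))) N - cesaro U N)
      = cesaro (\<lambda>n. e_unit (f n) * (birkhoff_sum F H (orb n) / of_nat H)) N - cesaro U N" for N
  proof -
    have "cesaro (\<lambda>n. e_unit (f n) * (birkhoff_sum F H (orb n) / of_nat H)) N
        = cesaro (\<lambda>n. (1 / of_nat H) * (\<Sum>h<H. e_unit (f n) * F (orb (n + h)))) N"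
      by (simp add: birkhoff_sum_def orb_add sum_distrib_left sum_divide_distrib)
    then show ?thesis
      using \<open>H > 0\<close> by (simp only: cesaro_cmult cesaro_sum) (simp add: sum_subtractf diff_divide_distrib)
  qed
  ultimately show ?thesis by (simp add: U_def[abs_def])
qed

text \<open>Along the refined bad subsequence, passing from \<open>F\<close> to its Birkhoff
  averages of length \<open>H\<close> costs \<open>e / 8\<close>, passing from these to the constant
  \<open>I\<close> costs \<open>e / 8\<close>, and the average of the phase costs
  \<open>e / 2\<close> because \<open>norm I \<le> 1\<close>. The total is below
  \<open>e\<close>.\<close>

lemma cesaro_decaying_0:
  assumes f: "decaying_difference 0 \<kappa> f" and "\<kappa> > 0" "e > 0" and \<kappa>e: "1 / \<kappa> \<le> e / 2"
    and F: "continuous_on seq_space F" "\<And>x. x \<in> seq_space \<Longrightarrow> norm (F x) \<le> 1"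
  shows "\<forall>\<^sub>F N in sequentially. norm (cesaro (\<lambda>n. e_unit (f n) * F (orb n)) N) \<le> e"
proof (rule ccontr)
  define U where "U n = e_unit (f n) * F (orb n)" for n
  have f': "fdiff f \<longlonglongrightarrow> 0" using f by (simp add: decaying_difference_def)
  assume "\<not> ?thesis"
  then obtain s :: "nat \<Rightarrow> nat" where s: "strict_mono s" "\<And>k. norm (cesaro U (s k)) > e"
    using not_eventually_sequentiallyD by (fastforce simp: U_def[abs_def] not_le)
  have "s k > 0" for k
    using s(2)[of k] \<open>e > 0\<close> by (cases "s k = 0") (auto simp: cesaro_def)
  then obtain r \<mu> where r: "strict_mono (r :: nat \<Rightarrow> nat)" and inv: "shift_invariant_measure \<mu>"
    and erg: "ergodic_system \<mu> seq_shift"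
    and lim: "\<And>F. continuous_on seq_space F \<Longrightarrow> (\<lambda>k. cesaro (\<lambda>m. F (orb m)) (s (r k))) \<longlonglongrightarrow> (\<integral>x. F x \<partial>\<mu>)"
    using Furstenberg_limit[OF s(1)] by metis
  interpret shift_invariant_measure \<mu> by (rule inv)
  have sr: "strict_mono (\<lambda>k. s (r k))" using strict_mono_o[OF s(1) r] by (simp add: o_def)
  define I where "I = (\<integral>x. F x \<partial>\<mu>)"
  have "norm I \<le> 1"
    by (rule Lim_norm_ubound[OF _ lim[OF F(1), folded I_def]]) (auto intro!: always_eventually norm_cesaro_le F)
  have "\<forall>\<^sub>F n in sequentially. dist (\<integral>x. norm (birkhoff_sum F n x / of_nat n - I) \<partial>\<mu>) 0 < e / 8"
    using mean_ergodic[OF erg F(1)] \<open>e > 0\<close> unfolding I_def by (intro tendstoD) auto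
  then have "\<forall>\<^sub>F n in sequentially. n > 0 \<and> (\<integral>x. norm (birkhoff_sum F n x / of_nat n - I) \<partial>\<mu>) < e / 8"
    using eventually_gt_at_top[of 0] by eventually_elim auto
  then obtain H where H: "H > 0" "(\<integral>x. norm (birkhoff_sum F H x / of_nat H - I) \<partial>\<mu>) < e / 8"
    using eventually_happens'[OF sequentially_bot] by blast
  define G where "G x = norm (birkhoff_sum F H x / of_nat H - I)" for x
  have "continuous_on seq_space (\<lambda>x. complex_of_real (G x))"
    unfolding G_def using \<open>H > 0\<close> by (intro continuous_intros continuous_birkhoff_sum F) auto
  from tendsto_Re[OF lim[OF this]]
  have "(\<lambda>k. Re (cesaro (\<lambda>m. complex_of_real (G (orb m))) (s (r k)))) \<longlonglongrightarrow> (\<integral>x. G x \<partial>\<mu>)" by simp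
  then have 1: "\<forall>\<^sub>F k in sequentially. Re (cesaro (\<lambda>m. complex_of_real (G (orb m))) (s (r k))) < e / 8"
    using H by (intro order_tendstoD) (auto simp: G_def)
  define V where "V n = e_unit (f n) * (birkhoff_sum F H (orb n) / of_nat H)" for n
  have "\<forall>\<^sub>F N in sequentially. dist (cesaro V N - cesaro U N) 0 < e / 8"
    using cesaro_slow_birkhoff[OF f' F H(1)] \<open>e > 0\<close>
    unfolding V_def[abs_def] U_def[abs_def] by (intro tendstoD) auto
  from eventually_subseq[OF sr this] have 2: "\<forall>\<^sub>F k in sequentially. norm (cesaro V (s (r k)) - cesaro U (s (r k))) < e / 8"
    by simp
  have "\<forall>\<^sub>F N in sequentially. norm (cesaro (\<lambda>n. e_unit (f n)) N) \<le> 1 / \<kappa>"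
    by (rule cesaro_e_unit_slow) (use f \<open>\<kappa> > 0\<close> in \<open>simp_all add: decaying_difference_def fdiff_def[abs_def]\<close>)
  from eventually_subseq[OF sr this] have 3: "\<forall>\<^sub>F k in sequentially. norm (cesaro (\<lambda>n. e_unit (f n)) (s (r k))) \<le> 1 / \<kappa>"
    by simp
  from 1 2 3 have "\<forall>\<^sub>F k in sequentially. False"
  proof eventually_elim
    case (elim k)
    define N where "N = s (r k)"
    have "norm (cesaro (\<lambda>n. V n - I * e_unit (f n)) N) \<le> Re (cesaro (\<lambda>m. complex_of_real (G (orb m))) N)"
    proof (rule norm_cesaro_le_Re)
      fix n
      have "V n - I * e_unit (f n) = e_unit (f n) * (birkhoff_sum F H (orb n) / of_nat H - I)"
        by (simp add: V_def algebra_simps)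
      then show "norm (V n - I * e_unit (f n)) \<le> G (orb n)" by (simp add: norm_mult G_def)
    qed
    then have a: "norm (cesaro V N - I * cesaro (\<lambda>n. e_unit (f n)) N) < e / 8"
      using elim by (simp add: cesaro_diff cesaro_cmult N_def)
    have "norm (I * cesaro (\<lambda>n. e_unit (f n)) N) \<le> 1 * (1 / \<kappa>)"
      unfolding norm_mult using elim \<open>norm I \<le> 1\<close> by (intro mult_mono) (auto simp: N_def)
    then have b: "norm (I * cesaro (\<lambda>n. e_unit (f n)) N) \<le> e / 2" using \<kappa>e by simp
    have c: "norm (cesaro V N - cesaro U N) < e / 8" using elim by (simp add: N_def)
    have d: "norm (cesaro U N) > e" using s(2) by (simp add: N_def)
    have "norm (cesaro U N) \<le> norm (cesaro V N) + norm (cesaro V N - cesaro U N)"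
      using norm_triangle_sub[of "cesaro U N" "cesaro V N"] by (simp add: norm_minus_commute)
    moreover have "norm (cesaro V N) \<le> norm (I * cesaro (\<lambda>n. e_unit (f n)) N)
        + norm (cesaro V N - I * cesaro (\<lambda>n. e_unit (f n)) N)"
      by (rule norm_triangle_sub)
    ultimately show False using a b c d \<open>e > 0\<close> by argo
  qed
  then show False by simp
qed

text \<open>A shift by \<open>h\<close> raises the constant to \<open>h * \<kappa> / 2\<close>. For
  \<open>h \<ge> 2 * \<kappa>0 / \<kappa>\<close> this reaches the threshold
  \<open>\<kappa>0\<close> that the induction hypothesis assigns to \<open>e\<close>, however small
  \<open>\<kappa>\<close> is. Large shifts alone therefore give small correlations, which is the
  form of the hypothesis of \<open>van_der_Corput\<close>.\<close>

lemma cesaro_decaying_Suc: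
  assumes IH: "\<And>e. e > 0 \<Longrightarrow> \<exists>\<kappa>>0. \<forall>f F. decaying_difference d \<kappa> f \<longrightarrow> continuous_on seq_space F \<longrightarrow>
      (\<forall>x\<in>seq_space. norm (F x) \<le> 1) \<longrightarrow>
      (\<forall>\<^sub>F N in sequentially. norm (cesaro (\<lambda>n. e_unit (f n) * F (orb n)) N) \<le> e)"
    and f: "decaying_difference (Suc d) \<kappa> f" and "\<kappa> > 0"
    and F: "continuous_on seq_space F" "\<And>x. x \<in> seq_space \<Longrightarrow> norm (F x) \<le> 1"
  shows "cesaro (\<lambda>n. e_unit (f n) * F (orb n)) \<longlonglongrightarrow> 0"
proof (rule van_der_Corput)
  show "norm (e_unit (f n) * F (orb n)) \<le> 1" for n by (simp add: norm_mult F)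
  fix e :: real assume "e > 0"
  from IH[OF this] obtain \<kappa>0 where \<kappa>0: "\<And>f F. decaying_difference d \<kappa>0 f \<Longrightarrow> continuous_on seq_space F \<Longrightarrow>
      \<forall>x\<in>seq_space. norm (F x) \<le> 1 \<Longrightarrow>
      \<forall>\<^sub>F N in sequentially. norm (cesaro (\<lambda>n. e_unit (f n) * F (orb n)) N) \<le> e"
    by blast
  obtain h0 :: nat where h0: "real h0 \<ge> 2 * \<kappa>0 / \<kappa>" using real_arch_simple by blast
  show "\<exists>h0. \<forall>h\<ge>h0. \<forall>\<^sub>F N in sequentially.
      norm (cesaro (\<lambda>n. e_unit (f (n + h)) * F (orb (n + h)) * cnj (e_unit (f n) * F (orb n))) N) \<le> e"
  proof (intro exI[of _ h0] allI impI)
    fix h assume "h0 \<le> h"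
    define F' where "F' x = F ((seq_shift ^^ h) x) * cnj (F x)" for x
    have "2 * \<kappa>0 / \<kappa> \<le> real h" using h0 \<open>h0 \<le> h\<close> by linarith
    then have "\<kappa>0 \<le> h * \<kappa> / 2" using \<open>\<kappa> > 0\<close> by (simp add: field_simps)
    then have "decaying_difference d \<kappa>0 (\<lambda>n. f (n + h) - f n)"
      using decaying_difference_shift_diff[OF f \<open>\<kappa> > 0\<close>] by (blast intro: decaying_difference_mono)
    moreover have "continuous_on seq_space F'"
      unfolding F'_def by (intro continuous_intros continuous_compose_funpow_shift F)
    moreover have "\<forall>x\<in>seq_space. norm (F' x) \<le> 1"
      using F(2) by (auto simp: F'_def norm_mult intro!: mult_le_one)
    ultimately have "\<forall>\<^sub>F N in sequentially. norm (cesaro (\<lambda>n. e_unit (f (n + h) - f n) * F' (orb n)) N) \<le> e"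
      by (rule \<kappa>0)
    then show "\<forall>\<^sub>F N in sequentially.
      norm (cesaro (\<lambda>n. e_unit (f (n + h)) * F (orb (n + h)) * cnj (e_unit (f n) * F (orb n))) N) \<le> e"
      by (simp add: F'_def e_unit_diff orb_add mult_ac)
  qed
qed

text \<open>The threshold is chosen before \<open>f\<close> and \<open>F\<close>, since both change
  with each shift. With at least one van der Corput step every positive value serves, here 1; in the
  base case it is \<open>2 / e\<close>, so that \<open>1 / \<kappa>\<close> equals
  \<open>e / 2\<close>.\<close>

lemma cesaro_decaying:
  assumes "e > 0"
  shows "\<exists>\<kappa>>0. \<forall>f F. decaying_difference d \<kappa> f \<longrightarrow> continuous_on seq_space F \<longrightarrow>
      (\<forall>x\<in>seq_space. norm (F x) \<le> 1) \<longrightarrow>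
      (\<forall>\<^sub>F N in sequentially. norm (cesaro (\<lambda>n. e_unit (f n) * F (orb n)) N) \<le> e)"
  using assms
proof (induction d arbitrary: e)
  case 0
  then show ?case
    using cesaro_decaying_0[of "2 / e" _ e] by (intro exI[of _ "2 / e"]) auto
next
  case (Suc d)
  show ?case
  proof (intro exI[of _ 1] conjI allI impI)
    fix f :: "nat \<Rightarrow> real" and F :: "(int \<Rightarrow> complex) \<Rightarrow> complex"
    assume *: "decaying_difference (Suc d) 1 f" "continuous_on seq_space F" "\<forall>x\<in>seq_space. norm (F x) \<le> 1"
    have "cesaro (\<lambda>n. e_unit (f n) * F (orb n)) \<longlonglongrightarrow> 0"
      by (rule cesaro_decaying_Suc[OF Suc.IH *(1)]) (use * in auto)
    from tendstoD[OF this \<open>e > 0\<close>]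
    show "\<forall>\<^sub>F N in sequentially. norm (cesaro (\<lambda>n. e_unit (f n) * F (orb n)) N) \<le> e"
      by (auto elim!: eventually_mono)
  qed simp
qed

end

text \<open>The first alternative is growth strictly above \<open>t ^ d * ln t\<close>. The second
  is growth equal to it, where a single constant is available and at least one van der Corput step
  has to enlarge it.\<close>

definition admissible_seq :: "(nat \<Rightarrow> real) \<Rightarrow> bool" where
  "admissible_seq f \<longleftrightarrow> (\<exists>d. (\<forall>\<kappa>. decaying_difference d \<kappa> f) \<or> (\<exists>\<kappa>>0. d \<ge> 1 \<and> decaying_difference d \<kappa> f))"

lemma admissible_seq_cmult:
  assumes "admissible_seq f" "c > 0"
  shows "admissible_seq (\<lambda>n. c * f n)"
proof -
  obtain d where "(\<forall>\<kappa>. decaying_difference d \<kappa> f) \<or> (\<exists>\<kappa>>0. d \<ge> 1 \<and> decaying_difference d \<kappa> f)"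
    using assms by (auto simp: admissible_seq_def)
  then show ?thesis
  proof
    assume *: "\<forall>\<kappa>. decaying_difference d \<kappa> f"
    have "decaying_difference d \<kappa> (\<lambda>n. c * f n)" for \<kappa>
      using decaying_difference_cmult[OF *[rule_format, of "\<kappa> / c"] \<open>c > 0\<close>] \<open>c > 0\<close> by simp
    then show ?thesis by (auto simp: admissible_seq_def)
  next
    assume "\<exists>\<kappa>>0. d \<ge> 1 \<and> decaying_difference d \<kappa> f"
    then show ?thesis
      using decaying_difference_cmult[OF _ \<open>c > 0\<close>] \<open>c > 0\<close> unfolding admissible_seq_def by (meson mult_pos_pos)
  qed
qed

context ergodic_sequence
begin

lemma cesaro_admissible_aux:
  assumes f: "admissible_seq f"
    and F: "continuous_on seq_space F" "\<And>x. x \<in> seq_space \<Longrightarrow> norm (F x) \<le> 1"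
  shows "cesaro (\<lambda>n. e_unit (f n) * F (orb n)) \<longlonglongrightarrow> 0"
proof -
  obtain d where "(\<forall>\<kappa>. decaying_difference d \<kappa> f) \<or> (\<exists>\<kappa>>0. d \<ge> 1 \<and> decaying_difference d \<kappa> f)"
    using f by (auto simp: admissible_seq_def)
  then show ?thesis
  proof
    assume *: "\<forall>\<kappa>. decaying_difference d \<kappa> f"
    show ?thesis
    proof (rule tendstoI)
      fix e :: real assume "e > 0"
      then have "\<forall>\<^sub>F N in sequentially. norm (cesaro (\<lambda>n. e_unit (f n) * F (orb n)) N) \<le> e / 2"
        using cesaro_decaying[of "e / 2" d] * F by auto
      then show "\<forall>\<^sub>F N in sequentially. dist (cesaro (\<lambda>n. e_unit (f n) * F (orb n)) N) 0 < e"
        by eventually_elim (use \<open>e > 0\<close> in auto)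
    qed
  next
    assume "\<exists>\<kappa>>0. d \<ge> 1 \<and> decaying_difference d \<kappa> f"
    then obtain \<kappa> d' where "\<kappa> > 0" "decaying_difference (Suc d') \<kappa> f" by (cases d) auto
    then show ?thesis using cesaro_decaying_Suc[OF cesaro_decaying] F by blast
  qed
qed

text \<open>Negative \<open>\<beta>\<close> reduces to positive by conjugating the average;
  \<open>F\<close> is conjugated with it and remains an allowed function.\<close>

theorem cesaro_admissible:
  assumes f: "admissible_seq f" and "\<beta> \<noteq> 0"
    and F: "continuous_on seq_space F" "\<And>x. x \<in> seq_space \<Longrightarrow> norm (F x) \<le> 1"
  shows "cesaro (\<lambda>n. e_unit (\<beta> * f n) * F (orb n)) \<longlonglongrightarrow> 0"
proof (cases "\<beta> > 0")
  case True
  then show ?thesis using cesaro_admissible_aux[OF admissible_seq_cmult[OF f]] F by blast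
next
  case False
  then have "- \<beta> > 0" using \<open>\<beta> \<noteq> 0\<close> by simp
  then have "cesaro (\<lambda>n. e_unit ((- \<beta>) * f n) * cnj (F (orb n))) \<longlonglongrightarrow> 0"
    by (intro cesaro_admissible_aux[of _ "\<lambda>x. cnj (F x)"] admissible_seq_cmult f continuous_intros F)
       (use F in auto)
  then have "cesaro (\<lambda>n. cnj (e_unit (\<beta> * f n) * F (orb n))) \<longlonglongrightarrow> 0"
    by (simp add: cnj_e_unit)
  then have "(\<lambda>N. cnj (cesaro (\<lambda>n. e_unit (\<beta> * f n) * F (orb n)) N)) \<longlonglongrightarrow> cnj 0"
    unfolding cesaro_cnj[abs_def] by simp
  then show ?thesis by (simp only: lim_cnj)
qed

end

section \<open>Hardy field functions\<close>

lemma germ_of_eq_iff: "germ_of f = germ_of g \<longleftrightarrow> (\<forall>\<^sub>F t in at_top. f t = g t)"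
  by (rule germ.abs_eq_iff)

text \<open>The definition differentiates some representative of the germ. It agrees with
  \<open>f\<close> on a half line, and at interior points of that half line the derivative carries
  over.\<close>

lemma Hardy_field_derivative:
  assumes "Hardy_field H" "germ_of f \<in> H"
  shows "\<exists>g. germ_of g \<in> H \<and> (\<forall>\<^sub>F t in at_top. (f has_real_derivative g t) (at t))"
proof -
  obtain f' g where fg: "germ_of f' = germ_of f" "germ_of g \<in> H"
    and d: "\<forall>\<^sub>F t in at_top. (f' has_real_derivative g t) (at t)"
    using assms unfolding Hardy_field_def germ_has_derivative_def by metis
  have "\<forall>\<^sub>F t in at_top. f' t = f t" using fg by (simp add: germ_of_eq_iff)
  then obtain c where c: "\<And>t. t \<ge> c \<Longrightarrow> f' t = f t" by (auto simp: eventually_at_top_linorder)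
  from d eventually_gt_at_top[of c]
  have "\<forall>\<^sub>F t in at_top. (f has_real_derivative g t) (at t)"
  proof eventually_elim
    case (elim t)
    show ?case
      by (rule has_field_derivative_transform_within_open[OF elim(1), of "{c<..}"]) (use elim c in auto)
  qed
  then show ?thesis using fg by blast
qed

lemma Hardy_field_inverse:
  assumes "Hardy_field H" "germ_of f \<in> H" "\<not> (\<forall>\<^sub>F t in at_top. f t = 0)"
  shows "\<exists>u. germ_of u \<in> H \<and> (\<forall>\<^sub>F t in at_top. f t * u t = 1)"
proof -
  have "germ_of f \<noteq> 0" using assms by (simp add: zero_germ.abs_eq germ_of_eq_iff)
  then obtain y where y: "y \<in> H" "germ_of f * y = 1"
    using assms unfolding Hardy_field_def is_subfield_def by blast
  obtain u where "y = germ_of u" using Quotient_abs_rep[OF Quotient_germ] by metis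
  with y show ?thesis
    by (intro exI[of _ u]) (simp add: times_germ.abs_eq one_germ.abs_eq germ_of_eq_iff)
qed

lemma Hardy_field_uminus: "Hardy_field H \<Longrightarrow> germ_of f \<in> H \<Longrightarrow> germ_of (\<lambda>t. - f t) \<in> H"
  unfolding Hardy_field_def is_subfield_def using uminus_germ.abs_eq[of f] by metis

text \<open>A nonzero germ is invertible, so \<open>f\<close> has no zeros far out; being
  differentiable there it is continuous, and a connected image that avoids 0 lies on one side of
  it.\<close>

lemma Hardy_field_sign:
  assumes H: "Hardy_field H" and f: "germ_of f \<in> H"
  shows "(\<forall>\<^sub>F t in at_top. f t = 0) \<or> (\<forall>\<^sub>F t in at_top. f t > 0) \<or> (\<forall>\<^sub>F t in at_top. f t < 0)"
proof (cases "\<forall>\<^sub>F t in at_top. f t = 0")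
  case False
  from Hardy_field_inverse[OF H f False] obtain u where "\<forall>\<^sub>F t in at_top. f t * u t = 1" by blast
  moreover obtain g where "\<forall>\<^sub>F t in at_top. (f has_real_derivative g t) (at t)"
    using Hardy_field_derivative[OF H f] by blast
  ultimately have "\<forall>\<^sub>F t in at_top. f t \<noteq> 0 \<and> isCont f t"
    by eventually_elim (auto intro: DERIV_isCont)
  then obtain c where c: "\<And>t. t \<ge> c \<Longrightarrow> f t \<noteq> 0" "\<And>t. t \<ge> c \<Longrightarrow> isCont f t"
    by (auto simp: eventually_at_top_linorder)
  have "continuous_on {c..} f" using c(2) by (intro continuous_at_imp_continuous_on) auto
  then have int: "is_interval (f ` {c..})"
    by (subst is_interval_connected_1) (rule connected_continuous_image, auto)
  have "(\<forall>t\<ge>c. f t > 0) \<or> (\<forall>t\<ge>c. f t < 0)"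
  proof (rule ccontr)
    assume "\<not> ?thesis"
    then obtain s t where "s \<ge> c" "f s \<le> 0" "t \<ge> c" "f t \<ge> 0" by (auto simp: not_less)
    then have "0 \<in> f ` {c..}" using int unfolding is_interval_1 by (meson atLeast_iff imageI)
    then show False using c(1) by auto
  qed
  then show ?thesis by (auto simp: eventually_at_top_linorder)
qed simp

lemma nondecreasing_at_top_cases:
  fixes f :: "real \<Rightarrow> real"
  assumes mono: "\<And>s t. c \<le> s \<Longrightarrow> s \<le> t \<Longrightarrow> f s \<le> f t"
  shows "(\<exists>L. (f \<longlongrightarrow> L) at_top) \<or> filterlim f at_top at_top"
proof (cases "bdd_above (f ` {c..})")
  case True
  have "(f \<longlongrightarrow> Sup (f ` {c..})) at_top"
  proof (rule order_tendstoI)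
    fix y assume "y < Sup (f ` {c..})"
    then obtain s where s: "s \<ge> c" "y < f s"
      using less_cSup_iff[OF _ True, of y] by auto
    show "\<forall>\<^sub>F t in at_top. y < f t"
      using eventually_ge_at_top[of s] by eventually_elim (use s mono in force)
  next
    fix y assume y: "Sup (f ` {c..}) < y"
    show "\<forall>\<^sub>F t in at_top. f t < y"
      using eventually_ge_at_top[of c]
    proof eventually_elim
      case (elim t)
      then have "f t \<le> Sup (f ` {c..})" by (intro cSup_upper True) auto
      with y show ?case by simp
    qed
  qed
  then show ?thesis by blast
next
  case False
  have "filterlim f at_top at_top"
    unfolding filterlim_at_top
  proof
    fix Z
    obtain s where s: "s \<ge> c" "Z \<le> f s"
      using False unfolding bdd_above_def by (metis atLeast_iff imageE linear)
    show "\<forall>\<^sub>F t in at_top. Z \<le> f t"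
      using eventually_ge_at_top[of s] by eventually_elim (use s mono in force)
  qed
  then show ?thesis by blast
qed

text \<open>The derivative lies in the field and has an eventual sign, so \<open>f\<close> is
  eventually monotone.\<close>

lemma Hardy_field_limit:
  assumes H: "Hardy_field H" and f: "germ_of f \<in> H"
  shows "(\<exists>L. (f \<longlongrightarrow> L) at_top) \<or> filterlim f at_top at_top \<or> filterlim f at_bot at_top"
proof -
  obtain g where g: "germ_of g \<in> H" and d: "\<forall>\<^sub>F t in at_top. (f has_real_derivative g t) (at t)"
    using Hardy_field_derivative[OF H f] by blast
  from Hardy_field_sign[OF H g]
  have "(\<forall>\<^sub>F t in at_top. g t \<ge> 0) \<or> (\<forall>\<^sub>F t in at_top. g t \<le> 0)"
    by (elim disjE) (rule disjI1, erule eventually_mono, simp, rule disjI1, erule eventually_mono, simp,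
        rule disjI2, erule eventually_mono, simp)
  then show ?thesis
  proof
    assume "\<forall>\<^sub>F t in at_top. g t \<ge> 0"
    from eventually_conj[OF this d] obtain c
      where c: "\<And>t. t \<ge> c \<Longrightarrow> g t \<ge> 0 \<and> (f has_real_derivative g t) (at t)"
      by (auto simp: eventually_at_top_linorder)
    have "f s \<le> f t" if "c \<le> s" "s \<le> t" for s t
      by (rule DERIV_nonneg_imp_nondecreasing[OF that(2)]) (use that c in \<open>meson order_trans\<close>)
    from nondecreasing_at_top_cases[of c f, OF this] show ?thesis by blast
  next
    assume "\<forall>\<^sub>F t in at_top. g t \<le> 0"
    from eventually_conj[OF this d] obtain c
      where c: "\<And>t. t \<ge> c \<Longrightarrow> g t \<le> 0 \<and> (f has_real_derivative g t) (at t)"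
      by (auto simp: eventually_at_top_linorder)
    have "- f s \<le> - f t" if "c \<le> s" "s \<le> t" for s t
      using DERIV_nonpos_imp_nonincreasing[OF that(2), of f] c that by (meson neg_le_iff_le order_trans)
    from nondecreasing_at_top_cases[of c "\<lambda>t. - f t", OF this] show ?thesis
      using tendsto_minus_cancel_left filterlim_uminus_at_bot by blast
  qed
qed

section \<open>Growth of a function against its iterated derivatives\<close>

lemma derivative_ge_power_imp_ge:
  fixes f f' :: "real \<Rightarrow> real"
  assumes d: "\<forall>\<^sub>F t in at_top. (f has_real_derivative f' t) (at t)"
    and ge: "\<forall>\<^sub>F t in at_top. f' t \<ge> c * t ^ j" and "c > 0"
  shows "\<forall>\<^sub>F t in at_top. f t \<ge> c / (2 * real (Suc j)) * t ^ Suc j"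
proof -
  from eventually_conj[OF d ge] obtain b
    where b: "\<And>t. t \<ge> b \<Longrightarrow> (f has_real_derivative f' t) (at t) \<and> f' t \<ge> c * t ^ j"
    by (auto simp: eventually_at_top_linorder)
  define p where "p t = f t - c / real (Suc j) * t ^ Suc j" for t
  have p: "(p has_real_derivative (f' t - c * t ^ j)) (at t)" if "t \<ge> b" for t
    unfolding p_def using b[OF that] by (auto intro!: derivative_eq_intros simp del: power_Suc)
  have mono: "p b \<le> p t" if "b \<le> t" for t
    by (rule DERIV_nonneg_imp_nondecreasing[OF that]) (use p b in fastforce)
  \<comment> \<open>Integration gives the coefficient \<open>c / Suc j\<close> up to an additive
    constant; half of the power term is given up to absorb that constant.\<close>
  have "filterlim (\<lambda>t::real. c / (2 * real (Suc j)) * t ^ Suc j) at_top at_top"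
    by (rule filterlim_tendsto_pos_mult_at_top[OF tendsto_const _ filterlim_pow_at_top[OF _ filterlim_ident]])
       (use \<open>c > 0\<close> in auto)
  then have "\<forall>\<^sub>F t in at_top. - p b \<le> c / (2 * real (Suc j)) * t ^ Suc j"
    by (simp add: filterlim_at_top)
  with eventually_ge_at_top[of b] show ?thesis
  proof eventually_elim
    case (elim t)
    have "c / real (Suc j) * t ^ Suc j = 2 * (c / (2 * real (Suc j)) * t ^ Suc j)" by (simp add: field_simps)
    then show ?case using mono[OF elim(1)] elim(2) by (simp add: p_def del: power_Suc)
  qed
qed

lemma iterated_derivative_ge_imp_ge:
  assumes d: "\<And>j. \<forall>\<^sub>F t in at_top. (D j has_real_derivative D (Suc j) t) (at t)"
    and ge: "\<forall>\<^sub>F t in at_top. D k t \<ge> c" and "c > 0" and "j \<le> k"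
  shows "\<exists>c'>0. \<forall>\<^sub>F t in at_top. D (k - j) t \<ge> c' * t ^ j"
  using \<open>j \<le> k\<close>
proof (induction j)
  case 0
  then show ?case using ge \<open>c > 0\<close> by auto
next
  case (Suc j)
  then obtain c' where "c' > 0" "\<forall>\<^sub>F t in at_top. D (k - j) t \<ge> c' * t ^ j" by auto
  moreover have "k - j = Suc (k - Suc j)" using Suc.prems by simp
  ultimately have "\<forall>\<^sub>F t in at_top. D (k - Suc j) t \<ge> c' / (2 * real (Suc j)) * t ^ Suc j"
    using derivative_ge_power_imp_ge[OF d[of "k - Suc j"]] by simp
  then show ?case using \<open>c' > 0\<close> by (intro exI[of _ "c' / (2 * real (Suc j))"]) simp
qed

text \<open>The derivative \<open>D k\<close> has a limit, possibly infinite. If it were not 0, then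
  \<open>k\<close> integrations would force \<open>D 0\<close> or its negative above a positive
  multiple of \<open>t ^ k\<close>.\<close>

lemma tendsto_0_of_small_growth:
  assumes H: "Hardy_field H" and DH: "\<And>j. germ_of (D j) \<in> H"
    and d: "\<And>j. \<forall>\<^sub>F t in at_top. (D j has_real_derivative D (Suc j) t) (at t)"
    and small: "((\<lambda>t. D 0 t / t ^ k) \<longlongrightarrow> 0) at_top"
  shows "(D k \<longlongrightarrow> 0) at_top"
proof -
  have no: False if c: "c > 0" and ge: "\<forall>\<^sub>F t in at_top. E k t \<ge> c"
    and d: "\<And>j. \<forall>\<^sub>F t in at_top. (E j has_real_derivative E (Suc j) t) (at t)"
    and small: "((\<lambda>t. E 0 t / t ^ k) \<longlongrightarrow> 0) at_top" for c and E :: "nat \<Rightarrow> real \<Rightarrow> real"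
  proof -
    obtain c' where c': "c' > 0" "\<forall>\<^sub>F t in at_top. E 0 t \<ge> c' * t ^ k"
      using iterated_derivative_ge_imp_ge[where D = E, OF d ge c, of k] by auto
    have "\<forall>\<^sub>F t in at_top. E 0 t / t ^ k < c'" using small c' by (intro order_tendstoD) auto
    with c'(2) eventually_gt_at_top[of 0] have "\<forall>\<^sub>F t::real in at_top. False"
      by eventually_elim (simp add: field_simps)
    then show False by simp
  qed
  have d': "\<forall>\<^sub>F t in at_top. ((\<lambda>t. - D j t) has_real_derivative - D (Suc j) t) (at t)" for j
    using d[of j] by (auto elim!: eventually_mono intro: DERIV_minus)
  have small': "((\<lambda>t. - D 0 t / t ^ k) \<longlongrightarrow> 0) at_top" using tendsto_minus[OF small] by simp
  note no1 = no[of _ D, OF _ _ d small] and no2 = no[of _ "\<lambda>j t. - D j t", OF _ _ d' small']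
  from Hardy_field_limit[OF H DH[of k]] show ?thesis
  proof (elim disjE exE)
    fix L assume L: "(D k \<longlongrightarrow> L) at_top"
    have "\<not> L > 0"
    proof
      assume "L > 0"
      then have "\<forall>\<^sub>F t in at_top. L / 2 < D k t" by (intro order_tendstoD[OF L]) simp
      then have "\<forall>\<^sub>F t in at_top. L / 2 \<le> D k t" by eventually_elim simp
      then show False using no1[of "L / 2"] \<open>L > 0\<close> by simp
    qed
    moreover have "\<not> L < 0"
    proof
      assume "L < 0"
      then have "\<forall>\<^sub>F t in at_top. D k t < L / 2" by (intro order_tendstoD[OF L]) simp
      then have "\<forall>\<^sub>F t in at_top. - L / 2 \<le> - D k t" by eventually_elim simp
      then show False using no2[of "- L / 2"] \<open>L < 0\<close> by simp
    qed
    ultimately have "L = 0" by simp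
    with L show ?thesis by simp
  next
    assume "filterlim (D k) at_top at_top"
    then have "\<forall>\<^sub>F t in at_top. D k t \<ge> 1" by (simp add: filterlim_at_top)
    then show ?thesis using no1[of 1] by simp
  next
    assume "filterlim (D k) at_bot at_top"
    then have "\<forall>\<^sub>F t in at_top. D k t \<le> -1" by (simp add: filterlim_at_bot)
    then have "\<forall>\<^sub>F t in at_top. 1 \<le> - D k t" by eventually_elim simp
    then show ?thesis using no2[of 1] by simp
  qed
qed

text \<open>The Hardy field need not contain the identity function; the limit of \<open>t * g t\<close> still exists,
  because \<open>1 / g\<close> has a derivative in the field, which has a limit.\<close>

lemma Hardy_field_times_id_limit:
  assumes H: "Hardy_field H" and g: "germ_of g \<in> H"
  shows "(\<exists>K. ((\<lambda>t. t * g t) \<longlongrightarrow> K) at_top) \<or> filterlim (\<lambda>t. t * g t) at_infinity at_top"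
proof (cases "\<forall>\<^sub>F t in at_top. g t = 0")
  case True
  then have "\<forall>\<^sub>F t in at_top. t * g t = 0" by eventually_elim simp
  then show ?thesis by (blast intro: tendsto_eventually)
next
  case False
  from Hardy_field_inverse[OF H g False] obtain u
    where u: "germ_of u \<in> H" and gu: "\<forall>\<^sub>F t in at_top. g t * u t = 1" by blast
  obtain v where v: "germ_of v \<in> H" and d: "\<forall>\<^sub>F t in at_top. (u has_real_derivative v t) (at t)"
    using Hardy_field_derivative[OF H u] by blast
  have eq: "\<forall>\<^sub>F t in at_top. inverse (u t / t) = t * g t"
    using gu eventually_gt_at_top[of 0]
  proof eventually_elim
    case (elim t)
    then have "u t \<noteq> 0" by auto
    with elim show ?case by (simp add: field_simps)
  qed
  have half: "filterlim (\<lambda>t. u t / t) at_top at_top"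
    if "filterlim v at_top at_top" "\<forall>\<^sub>F t in at_top. (u has_real_derivative v t) (at t)" for u v :: "real \<Rightarrow> real"
    unfolding filterlim_at_top
  proof
    fix Z :: real
    define c where "c = max 1 (2 * Z)"
    have "\<forall>\<^sub>F t in at_top. c * t ^ 0 \<le> v t" using that(1) by (simp add: filterlim_at_top)
    from derivative_ge_power_imp_ge[OF that(2) this] have "\<forall>\<^sub>F t in at_top. c / 2 * t \<le> u t"
      by (simp add: c_def)
    with eventually_gt_at_top[of 0] show "\<forall>\<^sub>F t in at_top. Z \<le> u t / t"
    proof eventually_elim
      case (elim t)
      then have "Z * t \<le> c / 2 * t" by (intro mult_right_mono) (auto simp: c_def)
      then have "Z * t \<le> u t" using elim by linarith
      with elim show ?case by (simp add: pos_le_divide_eq)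
    qed
  qed
  have zero: "((\<lambda>t. t * g t) \<longlongrightarrow> 0) at_top" if "filterlim (\<lambda>t. u t / t) at_infinity at_top"
    using Lim_transform_eventually[OF filterlim_compose[OF tendsto_inverse_0 that] eq] .
  from Hardy_field_limit[OF H v] show ?thesis
  proof (elim disjE exE)
    fix L assume L: "(v \<longlongrightarrow> L) at_top"
    \<comment> \<open>The rule of l'Hospital compares \<open>u\<close> with the identity, so
      \<open>u t / t\<close> inherits the limit of \<open>v\<close>.\<close>
    have lim: "((\<lambda>t. u t / t) \<longlongrightarrow> L) at_top"
      by (rule lhospital_at_top_at_top[where f' = v and g' = "\<lambda>_. 1"])
         (use L d in \<open>auto simp: filterlim_ident\<close>)
    show ?thesis
    proof (cases "L = 0")
      case False
      then show ?thesis using Lim_transform_eventually[OF tendsto_inverse[OF lim] eq] by blast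
    next
      case True
      have "\<forall>\<^sub>F t in at_top. u t / t \<noteq> 0"
        using gu eventually_gt_at_top[of 0] by eventually_elim auto
      then have "filterlim (\<lambda>t. inverse (u t / t)) at_infinity at_top"
        using lim True by (intro filterlim_compose[OF filterlim_inverse_at_infinity] filterlim_atI) auto
      then have "filterlim (\<lambda>t. t * g t) at_infinity at_top"
        using filterlim_cong[OF refl refl eq] by blast
      then show ?thesis by blast
    qed
  next
    assume "filterlim v at_top at_top"
    from half[OF this d] show ?thesis
      using zero filterlim_mono[OF _ at_top_le_at_infinity order_refl] by blast
  next
    assume "filterlim v at_bot at_top"
    then have "filterlim (\<lambda>t. - v t) at_top at_top" by (simp add: filterlim_uminus_at_top)
    moreover have "\<forall>\<^sub>F t in at_top. ((\<lambda>t. - u t) has_real_derivative - v t) (at t)"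
      using d by (auto elim!: eventually_mono intro: DERIV_minus)
    ultimately have "filterlim (\<lambda>t. - u t / t) at_top at_top" by (rule half)
    then have "filterlim (\<lambda>t. u t / t) at_bot at_top" by (simp add: filterlim_uminus_at_bot)
    then show ?thesis
      using zero filterlim_mono[OF _ at_bot_le_at_infinity order_refl] by blast
  qed
qed

lemma power_ln_at_top: "filterlim (\<lambda>t::real. t ^ j * ln t) at_top at_top"
proof (induction j)
  case (Suc j)
  then show ?case
    using filterlim_at_top_mult_at_top[OF filterlim_ident Suc] by (simp add: mult.assoc)
qed (simp add: ln_at_top)

text \<open>The derivative of \<open>t ^ Suc j * ln t\<close> is \<open>Suc j\<close> times
  \<open>t ^ j * ln t\<close> plus the lower order term \<open>t ^ j\<close>, so the rule of
  l'Hospital divides the limit by \<open>Suc j\<close>.\<close>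

lemma power_ln_growth_step:
  assumes d: "\<forall>\<^sub>F t in at_top. (f has_real_derivative f' t) (at t)"
    and lim: "((\<lambda>t. f' t / (t ^ j * ln t)) \<longlongrightarrow> K) at_top"
  shows "((\<lambda>t. f t / (t ^ Suc j * ln t)) \<longlongrightarrow> K / real (Suc j)) at_top"
proof (rule lhospital_at_top_at_top[where f' = f' and g' = "\<lambda>t. real (Suc j) * t ^ j * ln t + t ^ j"])
  show "filterlim (\<lambda>t::real. t ^ Suc j * ln t) at_top at_top" by (rule power_ln_at_top)
  show "\<forall>\<^sub>F t in at_top. (f has_real_derivative f' t) (at t)" by (rule d)
  show "\<forall>\<^sub>F t in at_top. real (Suc j) * t ^ j * ln t + t ^ j \<noteq> 0"
    using eventually_gt_at_top[of 1]
  proof eventually_elim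
    case (elim t)
    then have "0 < t ^ j" "0 \<le> real (Suc j) * t ^ j * ln t" by auto
    then show ?case by linarith
  qed
  show "\<forall>\<^sub>F t in at_top. ((\<lambda>t. t ^ Suc j * ln t) has_real_derivative real (Suc j) * t ^ j * ln t + t ^ j) (at t)"
    using eventually_gt_at_top[of 0]
  proof eventually_elim
    case (elim t)
    then show ?case
      using DERIV_mult'[OF DERIV_pow[of "Suc j" t] DERIV_ln_divide[OF elim]] by (simp add: add.commute)
  qed
  have "((\<lambda>t. f' t / (t ^ j * ln t) / (real (Suc j) + inverse (ln t))) \<longlongrightarrow> K / (real (Suc j) + 0)) at_top"
    by (intro tendsto_intros lim tendsto_inverse_0_at_top ln_at_top) auto
  moreover have "\<forall>\<^sub>F t in at_top. f' t / (t ^ j * ln t) / (real (Suc j) + inverse (ln t)) =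
      f' t / (real (Suc j) * t ^ j * ln t + t ^ j)"
    using eventually_gt_at_top[of 1]
  proof eventually_elim
    case (elim t)
    then have "ln t \<noteq> 0" "t \<noteq> 0" by auto
    then have "t ^ j * ln t * (real (Suc j) + inverse (ln t)) = real (Suc j) * t ^ j * ln t + t ^ j"
      by (simp add: field_simps)
    then show ?case by (simp only: divide_divide_eq_left)
  qed
  ultimately show "((\<lambda>t. f' t / (real (Suc j) * t ^ j * ln t + t ^ j)) \<longlongrightarrow> K / real (Suc j)) at_top"
    by (simp only: add_0_right) (rule Lim_transform_eventually)
qed

text \<open>Serves by contraposition: growth of \<open>D 0\<close> excludes certain limits of
  \<open>t * D (Suc k) t\<close>. The first step compares with \<open>ln t\<close>, whose derivative
  is \<open>1 / t\<close>; the following ones produce the factorial.\<close>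

lemma iterated_power_ln_growth:
  assumes d: "\<And>j. \<forall>\<^sub>F t in at_top. (D j has_real_derivative D (Suc j) t) (at t)"
    and lim: "((\<lambda>t. t * D (Suc k) t) \<longlongrightarrow> K) at_top" and "j \<le> k"
  shows "((\<lambda>t. D (k - j) t / (t ^ j * ln t)) \<longlongrightarrow> K / fact j) at_top"
  using \<open>j \<le> k\<close>
proof (induction j)
  case 0
  have "((\<lambda>t. D k t / ln t) \<longlongrightarrow> K) at_top"
  proof (rule lhospital_at_top_at_top[where f' = "D (Suc k)" and g' = "\<lambda>t. 1 / t"])
    show "filterlim (ln :: real \<Rightarrow> real) at_top at_top" by (rule ln_at_top)
    show "\<forall>\<^sub>F t in at_top. (D k has_real_derivative D (Suc k) t) (at t)" by (rule d)
    show "\<forall>\<^sub>F t in at_top. (1::real) / t \<noteq> 0"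
      using eventually_gt_at_top[of 0] by eventually_elim simp
    show "\<forall>\<^sub>F t in at_top. (ln has_real_derivative 1 / t) (at t)"
      using eventually_gt_at_top[of 0] by eventually_elim (rule DERIV_ln_divide)
    show "((\<lambda>t. D (Suc k) t / (1 / t)) \<longlongrightarrow> K) at_top" using lim by (simp add: mult.commute)
  qed
  then show ?case by simp
next
  case (Suc j)
  have "k - j = Suc (k - Suc j)" using Suc.prems by simp
  with Suc have "((\<lambda>t. D (Suc (k - Suc j)) t / (t ^ j * ln t)) \<longlongrightarrow> K / fact j) at_top" by simp
  from power_ln_growth_step[OF d this] show ?case by (simp add: mult.commute)
qed

section \<open>From derivatives to iterated differences\<close>

definition rdiff :: "(real \<Rightarrow> real) \<Rightarrow> real \<Rightarrow> real" where
  "rdiff f t = f (t + 1) - f t"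

lemma funpow_fdiff_real: "(fdiff ^^ k) (\<lambda>n. f (real n)) n = (rdiff ^^ k) f (real n)"
  by (induction k arbitrary: n) (auto simp: fdiff_def rdiff_def add.commute)

text \<open>Differences of a tower of derivatives form a tower again. The induction, taken over all
  towers, thus leaves one difference of \<open>D k\<close>, to which the ordinary mean value theorem
  applies; each order moves the point by at most 1.\<close>

lemma funpow_rdiff_mean_value:
  assumes "\<And>j t. j < k \<Longrightarrow> t \<ge> c \<Longrightarrow> (D j has_real_derivative D (Suc j) t) (at t)" and "t \<ge> c"
  shows "\<exists>\<xi>\<in>{t..t + real k}. (rdiff ^^ k) (D 0) t = D k \<xi>"
  using assms(1)
proof (induction k arbitrary: D)
  case 0
  then show ?case by auto
next
  case (Suc k)
  have shift: "((\<lambda>t. D j (t + 1)) has_real_derivative D (Suc j) (s + 1)) (at s)" if "j < Suc k" "s \<ge> c" for j s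
    using Suc.prems[OF that(1), of "s + 1"] that(2) by (simp add: DERIV_shift)
  have "\<exists>\<xi>\<in>{t..t + real k}. (rdiff ^^ k) (rdiff (D 0)) t = rdiff (D k) \<xi>"
  proof (rule Suc.IH[of "\<lambda>j. rdiff (D j)"])
    show "(rdiff (D j) has_real_derivative rdiff (D (Suc j)) s) (at s)" if "j < k" "s \<ge> c" for j s
      unfolding rdiff_def[abs_def] using that by (intro DERIV_diff shift Suc.prems) auto
  qed
  then obtain \<xi> where \<xi>: "\<xi> \<in> {t..t + real k}" "(rdiff ^^ k) (rdiff (D 0)) t = rdiff (D k) \<xi>" by blast
  obtain \<eta> where \<eta>: "\<xi> < \<eta>" "\<eta> < \<xi> + 1" "D k (\<xi> + 1) - D k \<xi> = (\<xi> + 1 - \<xi>) * D (Suc k) \<eta>"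
    using MVT2[of \<xi> "\<xi> + 1" "D k" "D (Suc k)"] Suc.prems[of k] \<xi> \<open>t \<ge> c\<close> by force
  have "(rdiff ^^ Suc k) (D 0) t = D (Suc k) \<eta>"
    using \<xi>(2) \<eta>(3) by (simp only: funpow_Suc_right o_apply) (simp add: rdiff_def[of "D k"])
  then show ?case using \<xi>(1) \<eta> by (intro bexI[of _ \<eta>]) auto
qed

text \<open>Monotonicity of the differences of order \<open>Suc k\<close> is the sign of those of
  order \<open>Suc (Suc k)\<close>. The mean value point is at most \<open>n + Suc k\<close>, hence
  at most \<open>2 * n\<close> for large \<open>n\<close>, and this costs the factor 2 in front of
  \<open>\<kappa>\<close>.\<close>

lemma decaying_difference_of_derivatives:
  assumes d: "\<And>j. \<forall>\<^sub>F t in at_top. (D j has_real_derivative D (Suc j) t) (at t)"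
    and lim: "(D (Suc k) \<longlongrightarrow> 0) at_top" and pos: "\<forall>\<^sub>F t in at_top. D (Suc k) t > 0"
    and dec: "\<forall>\<^sub>F t in at_top. D (Suc (Suc k)) t \<le> 0"
    and low: "\<forall>\<^sub>F t in at_top. t * D (Suc k) t \<ge> 2 * \<kappa>"
  shows "decaying_difference k \<kappa> (\<lambda>n. D 0 (real n))"
proof -
  have "\<forall>\<^sub>F t in at_top. \<forall>j\<in>{..Suc k}. (D j has_real_derivative D (Suc j) t) (at t)"
    using d by (intro eventually_ball_finite) auto
  then obtain c where c: "\<And>j t. j \<le> Suc k \<Longrightarrow> t \<ge> c \<Longrightarrow> (D j has_real_derivative D (Suc j) t) (at t)"
    by (auto simp: eventually_at_top_linorder)
  have mv: "\<exists>\<xi>\<in>{real n..real n + real i}. (fdiff ^^ i) (\<lambda>n. D 0 (real n)) n = D i \<xi>"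
    if "real n \<ge> c" "i \<le> Suc (Suc k)" for i n
    unfolding funpow_fdiff_real by (rule funpow_rdiff_mean_value[of _ c]) (use c that in auto)
  have transfer: "\<forall>\<^sub>F n in sequentially. \<exists>\<xi>. (fdiff ^^ i) (\<lambda>n. D 0 (real n)) n = D i \<xi> \<and> P \<xi>
      \<and> real n \<le> \<xi> \<and> \<xi> \<le> real n + real i"
    if "\<forall>\<^sub>F t in at_top. P t" "i \<le> Suc (Suc k)" for P i
  proof -
    obtain b where b: "\<And>t. t \<ge> b \<Longrightarrow> P t" using \<open>eventually P at_top\<close> by (auto simp: eventually_at_top_linorder)
    have "\<forall>\<^sub>F n in sequentially. real n \<ge> max b c"
      using filterlim_real_sequentially by (simp only: filterlim_at_top)
    then show ?thesis
    proof eventually_elim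
      case (elim n)
      with mv[of n i] that(2) obtain \<xi> where "\<xi> \<in> {real n..real n + real i}"
        "(fdiff ^^ i) (\<lambda>n. D 0 (real n)) n = D i \<xi>" by auto
      with elim b show ?case by (intro exI[of _ \<xi>]) auto
    qed
  qed
  have "(fdiff ^^ Suc k) (\<lambda>n. D 0 (real n)) \<longlonglongrightarrow> 0"
  proof (rule tendstoI)
    fix e :: real assume "e > 0"
    from transfer[OF tendstoD[OF lim this], of "Suc k"]
    show "\<forall>\<^sub>F n in sequentially. dist ((fdiff ^^ Suc k) (\<lambda>n. D 0 (real n)) n) 0 < e"
      by (auto elim!: eventually_mono simp del: funpow.simps)
  qed
  moreover have "\<forall>\<^sub>F n in sequentially. (fdiff ^^ Suc k) (\<lambda>n. D 0 (real n)) (Suc n) \<le> (fdiff ^^ Suc k) (\<lambda>n. D 0 (real n)) n"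
  proof -
    from transfer[OF dec, of "Suc (Suc k)"]
    have "\<forall>\<^sub>F n in sequentially. fdiff ((fdiff ^^ Suc k) (\<lambda>n. D 0 (real n))) n \<le> 0"
      by (auto elim!: eventually_mono)
    then show ?thesis by eventually_elim (simp only: fdiff_def diff_le_0_iff_le)
  qed
  moreover have "\<forall>\<^sub>F n in sequentially. \<kappa> \<le> n * (fdiff ^^ Suc k) (\<lambda>n. D 0 (real n)) n"
    using transfer[OF eventually_conj[OF pos low] le_SucI[OF order_refl]] eventually_ge_at_top[of "Suc k"]
  proof eventually_elim
    case (elim n)
    then obtain \<xi> where \<xi>: "(fdiff ^^ Suc k) (\<lambda>n. D 0 (real n)) n = D (Suc k) \<xi>" "D (Suc k) \<xi> > 0"
      "2 * \<kappa> \<le> \<xi> * D (Suc k) \<xi>" "\<xi> \<le> real n + real (Suc k)" by blast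
    have "\<xi> \<le> 2 * real n" using \<xi> elim by linarith
    then have "\<xi> * D (Suc k) \<xi> \<le> 2 * real n * D (Suc k) \<xi>" using \<xi> by (intro mult_right_mono) auto
    then have "\<kappa> \<le> real n * D (Suc k) \<xi>" using \<xi>(3) by linarith
    then show ?case using \<xi>(1) by (simp only:)
  qed
  ultimately show ?thesis unfolding decaying_difference_def by blast
qed

text \<open>A positive function with limit 0 cannot increase from some point on, so the trichotomy
  of signs leaves a nonpositive next derivative.\<close>

lemma Hardy_decaying_difference:
  assumes H: "Hardy_field H" and DH: "\<And>j. germ_of (D j) \<in> H"
    and d: "\<And>j. \<forall>\<^sub>F t in at_top. (D j has_real_derivative D (Suc j) t) (at t)"
    and lim: "(D (Suc k) \<longlongrightarrow> 0) at_top" and pos: "\<forall>\<^sub>F t in at_top. D (Suc k) t > 0"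
    and low: "\<forall>\<^sub>F t in at_top. \<bar>t * D (Suc k) t\<bar> \<ge> 2 * \<kappa>"
  shows "decaying_difference k \<kappa> (\<lambda>n. D 0 (real n))"
proof (rule decaying_difference_of_derivatives[where D = D, OF d lim pos])
  show "\<forall>\<^sub>F t in at_top. t * D (Suc k) t \<ge> 2 * \<kappa>"
    using low pos eventually_gt_at_top[of 0] by eventually_elim simp
  have "\<not> (\<forall>\<^sub>F t in at_top. D (Suc (Suc k)) t > 0)"
  proof
    assume "\<forall>\<^sub>F t in at_top. D (Suc (Suc k)) t > 0"
    from eventually_conj[OF eventually_conj[OF this pos] d[of "Suc k"]] obtain c
      where c: "\<And>t. t \<ge> c \<Longrightarrow> D (Suc (Suc k)) t > 0 \<and> D (Suc k) t > 0 \<and>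
        (D (Suc k) has_real_derivative D (Suc (Suc k)) t) (at t)"
      by (auto simp: eventually_at_top_linorder)
    have mono: "D (Suc k) c \<le> D (Suc k) t" if "c \<le> t" for t
      by (rule DERIV_nonneg_imp_nondecreasing[OF that]) (use c in \<open>meson less_imp_le\<close>)
    have "D (Suc k) c > 0" using c by blast
    then have "\<forall>\<^sub>F t in at_top. D (Suc k) t < D (Suc k) c" by (rule order_tendstoD[OF lim])
    with eventually_ge_at_top[of c] have "\<forall>\<^sub>F t::real in at_top. False"
      by eventually_elim (use mono in force)
    then show False by simp
  qed
  with Hardy_field_sign[OF H DH[of "Suc (Suc k)"]]
  have "(\<forall>\<^sub>F t in at_top. D (Suc (Suc k)) t = 0) \<or> (\<forall>\<^sub>F t in at_top. D (Suc (Suc k)) t < 0)" by blast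
  then show "\<forall>\<^sub>F t in at_top. D (Suc (Suc k)) t \<le> 0"
    by (elim disjE) (erule eventually_mono, simp)+
qed

text \<open>If \<open>t * D (Suc k) t\<close> has a finite limit \<open>K\<close>, then
  \<open>a\<close> divided by \<open>t ^ k * ln t\<close> tends to \<open>K / fact k\<close>. Hence
  \<open>K = 0\<close> contradicts \<open>big\<close>, and when that quotient has no finite limit
  the product is unbounded in absolute value and every \<open>\<kappa>\<close> is reached. The sign
  \<open>\<sigma>\<close> makes the derivative of order \<open>Suc k\<close> positive.\<close>

lemma Hardy_function_growth:
  assumes a: "Hardy_field_function a"
    and small: "((\<lambda>t. a t / t ^ Suc k) \<longlongrightarrow> 0) at_top"
    and big: "\<not> ((\<lambda>t. a t / (t ^ k * ln t)) \<longlongrightarrow> 0) at_top"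
  shows "\<exists>\<sigma>\<in>{1, -1}. (\<exists>\<kappa>>0. decaying_difference k \<kappa> (\<lambda>n. \<sigma> * a (real n))) \<and>
     ((\<nexists>K. ((\<lambda>t. a t / (t ^ k * ln t)) \<longlongrightarrow> K) at_top) \<longrightarrow>
        (\<forall>\<kappa>. decaying_difference k \<kappa> (\<lambda>n. \<sigma> * a (real n))))"
proof -
  obtain H where H: "Hardy_field H" and aH: "germ_of a \<in> H"
    using a by (auto simp: Hardy_field_function_def)
  from Hardy_field_derivative[OF H] obtain der
    where der: "\<And>f. germ_of f \<in> H \<Longrightarrow> germ_of (der f) \<in> H \<and> (\<forall>\<^sub>F t in at_top. (f has_real_derivative der f t) (at t))"
    by metis
  define D where "D j = (der ^^ j) a" for j
  have D0: "D 0 = a" by (simp add: D_def)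
  have DH: "germ_of (D j) \<in> H" for j
    unfolding D_def by (induction j) (auto simp: aH der)
  have d: "\<forall>\<^sub>F t in at_top. (D j has_real_derivative D (Suc j) t) (at t)" for j
    using der[OF DH[of j]] by (simp add: D_def)
  have g0: "(D (Suc k) \<longlongrightarrow> 0) at_top"
    by (rule tendsto_0_of_small_growth[where D = D, OF H DH d]) (use small D0 in simp)
  have fin: "((\<lambda>t. a t / (t ^ k * ln t)) \<longlongrightarrow> K / fact k) at_top"
    if "((\<lambda>t. t * D (Suc k) t) \<longlongrightarrow> K) at_top" for K
    using iterated_power_ln_growth[where D = D, OF d that, of k] D0 by simp
  have all: "\<forall>\<^sub>F t in at_top. \<bar>t * D (Suc k) t\<bar> \<ge> \<kappa>" if "filterlim (\<lambda>t. t * D (Suc k) t) at_infinity at_top" for \<kappa>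
  proof -
    have "filterlim (\<lambda>t. norm (t * D (Suc k) t)) at_top at_top"
      using filterlim_at_infinity_imp_norm_at_top[OF that] .
    then show ?thesis by (simp add: filterlim_at_top)
  qed
  have low: "\<exists>\<kappa>>0. \<forall>\<^sub>F t in at_top. \<bar>t * D (Suc k) t\<bar> \<ge> 2 * \<kappa>"
    using Hardy_field_times_id_limit[OF H DH[of "Suc k"]]
  proof (elim disjE exE)
    fix K assume K: "((\<lambda>t. t * D (Suc k) t) \<longlongrightarrow> K) at_top"
    have "K \<noteq> 0" using fin[OF K] big by auto
    have "((\<lambda>t. \<bar>t * D (Suc k) t\<bar>) \<longlongrightarrow> \<bar>K\<bar>) at_top" by (rule tendsto_rabs[OF K])
    then have "\<forall>\<^sub>F t in at_top. \<bar>t * D (Suc k) t\<bar> > \<bar>K\<bar> / 2" using \<open>K \<noteq> 0\<close> by (intro order_tendstoD) auto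
    then show ?thesis
      using \<open>K \<noteq> 0\<close> by (intro exI[of _ "\<bar>K\<bar> / 4"]) (auto elim: eventually_mono)
  next
    assume "filterlim (\<lambda>t. t * D (Suc k) t) at_infinity at_top"
    then show ?thesis using all[of "2 * 1"] by (intro exI[of _ 1]) simp
  qed
  have low_all: "\<forall>\<^sub>F t in at_top. \<bar>t * D (Suc k) t\<bar> \<ge> 2 * \<kappa>"
    if "\<nexists>K. ((\<lambda>t. a t / (t ^ k * ln t)) \<longlongrightarrow> K) at_top" for \<kappa>
    using Hardy_field_times_id_limit[OF H DH[of "Suc k"]] fin that all by blast
  have "\<not> (\<forall>\<^sub>F t in at_top. D (Suc k) t = 0)"
  proof
    assume "\<forall>\<^sub>F t in at_top. D (Suc k) t = 0"
    then have "\<forall>\<^sub>F t in at_top. t * D (Suc k) t = 0" by eventually_elim simp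
    then show False using fin[of 0] big by (simp add: tendsto_eventually)
  qed
  with Hardy_field_sign[OF H DH[of "Suc k"]] consider
    (pos) "\<forall>\<^sub>F t in at_top. D (Suc k) t > 0" | (neg) "\<forall>\<^sub>F t in at_top. D (Suc k) t < 0" by blast
  then show ?thesis
  proof cases
    case pos
    note dd = Hardy_decaying_difference[where D = D, OF H DH d g0 pos]
    show ?thesis
      using low low_all dd by (intro bexI[of _ 1]) (auto simp: D0)
  next
    case neg
    have dd: "decaying_difference k \<kappa> (\<lambda>n. - a (real n))"
      if "\<forall>\<^sub>F t in at_top. \<bar>t * D (Suc k) t\<bar> \<ge> 2 * \<kappa>" for \<kappa>
      unfolding D0[symmetric]
    proof (rule Hardy_decaying_difference[OF H, of "\<lambda>j t. - D j t"])
      show "germ_of (\<lambda>t. - D j t) \<in> H" for j by (rule Hardy_field_uminus[OF H DH])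
      show "\<forall>\<^sub>F t in at_top. ((\<lambda>t. - D j t) has_real_derivative - D (Suc j) t) (at t)" for j
        using d[of j] by (auto elim!: eventually_mono intro: DERIV_minus)
      show "((\<lambda>t. - D (Suc k) t) \<longlongrightarrow> 0) at_top" using tendsto_minus[OF g0] by simp
    qed (use that neg in auto)
    show ?thesis using low low_all dd by (intro bexI[of _ "-1"]) auto
  qed
qed

theorem Hardy_function_admissible:
  assumes a: "Hardy_field_function a"
    and growth: "(\<exists>d::nat. (\<lambda>t. t ^ d * ln t) \<prec>\<^sub>g a \<and> a \<prec>\<^sub>g (\<lambda>t. t ^ (d + 1))) \<or>
         (\<exists>d::nat. d \<ge> 1 \<and> a \<sim>\<^sub>g (\<lambda>t. t ^ d * ln t))"
  shows "\<exists>\<sigma>\<in>{1, -1}. admissible_seq (\<lambda>n. \<sigma> * a (real n))"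
  using growth
proof (elim disjE exE conjE)
  fix d :: nat
  assume *: "(\<lambda>t. t ^ d * ln t) \<prec>\<^sub>g a" "a \<prec>\<^sub>g (\<lambda>t. t ^ (d + 1))"
  \<comment> \<open>A finite limit times the reciprocal quotient, which tends to 0, would give 0,
    yet the product is eventually 1.\<close>
  have no: "\<not> ((\<lambda>t. a t / (t ^ d * ln t)) \<longlongrightarrow> K) at_top" for K
  proof
    assume "((\<lambda>t. a t / (t ^ d * ln t)) \<longlongrightarrow> K) at_top"
    moreover have "((\<lambda>t. t ^ d * ln t / a t) \<longlongrightarrow> 0) at_top" "\<forall>\<^sub>F t in at_top. a t \<noteq> 0"
      using * by (auto simp: growth_prec_def)
    ultimately have "((\<lambda>t. a t / (t ^ d * ln t) * (t ^ d * ln t / a t)) \<longlongrightarrow> K * 0) at_top"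
      by (intro tendsto_mult)
    moreover have "\<forall>\<^sub>F t in at_top. a t / (t ^ d * ln t) * (t ^ d * ln t / a t) = 1"
      using \<open>\<forall>\<^sub>F t in at_top. a t \<noteq> 0\<close> eventually_gt_at_top[of 1]
      by eventually_elim simp
    ultimately have "((\<lambda>t::real. 1::real) \<longlongrightarrow> K * 0) at_top"
      by (rule Lim_transform_eventually)
    then show False by (simp add: tendsto_const_iff)
  qed
  have "((\<lambda>t. a t / t ^ Suc d) \<longlongrightarrow> 0) at_top" using * by (simp add: growth_prec_def)
  from Hardy_function_growth[OF a this no] no show ?thesis by (auto simp: admissible_seq_def)
next
  fix d :: nat
  assume d: "d \<ge> 1" and "a \<sim>\<^sub>g (\<lambda>t. t ^ d * ln t)"
  then obtain c where c: "c \<noteq> 0" "((\<lambda>t. a t / (t ^ d * ln t)) \<longlongrightarrow> c) at_top"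
    by (auto simp: growth_sim_def)
  have "((\<lambda>t. a t / (t ^ d * ln t) * (ln t / t)) \<longlongrightarrow> c * 0) at_top"
    by (intro tendsto_mult c ln_x_over_x_tendsto_0)
  moreover have "\<forall>\<^sub>F t in at_top. a t / (t ^ d * ln t) * (ln t / t) = a t / t ^ Suc d"
    using eventually_gt_at_top[of 1] by eventually_elim (simp add: field_simps)
  ultimately have "((\<lambda>t. a t / t ^ Suc d) \<longlongrightarrow> c * 0) at_top" by (rule Lim_transform_eventually)
  then have "((\<lambda>t. a t / t ^ Suc d) \<longlongrightarrow> 0) at_top" by simp
  moreover have "\<not> ((\<lambda>t. a t / (t ^ d * ln t)) \<longlongrightarrow> 0) at_top"
    using tendsto_unique[OF _ c(2)] c(1) by force
  ultimately show ?thesis using Hardy_function_growth[OF a] d unfolding admissible_seq_def by blast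
qed

section \<open>Integer parts\<close>

inductive trig_poly :: "(real \<Rightarrow> complex) \<Rightarrow> bool" where
  char: "trig_poly (\<lambda>t. c * e_unit (of_int k * t))"
| add: "trig_poly p \<Longrightarrow> trig_poly q \<Longrightarrow> trig_poly (\<lambda>t. p t + q t)"

lemma trig_poly_const: "trig_poly (\<lambda>t. c)"
  using trig_poly.char[of c 0] by simp

lemma trig_poly_mult_char:
  "trig_poly q \<Longrightarrow> trig_poly (\<lambda>t. (c * e_unit (of_int k * t)) * q t)"
proof (induction rule: trig_poly.induct)
  case (char c' k')
  have "(\<lambda>t. c * e_unit (of_int k * t) * (c' * e_unit (of_int k' * t)))
      = (\<lambda>t. (c * c') * e_unit (of_int (k + k') * t))"
    by (simp add: fun_eq_iff distrib_right e_unit_add)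
  then show ?case using trig_poly.char by metis
next
  case (add p q)
  then show ?case using trig_poly.add by (simp add: distrib_left)
qed

lemma trig_poly_mult: "trig_poly p \<Longrightarrow> trig_poly q \<Longrightarrow> trig_poly (\<lambda>t. p t * q t)"
proof (induction rule: trig_poly.induct)
  case (char c k)
  then show ?case by (rule trig_poly_mult_char)
next
  case (add p1 p2)
  then show ?case using trig_poly.add by (simp add: distrib_right)
qed

lemma trig_poly_cmult: "trig_poly q \<Longrightarrow> trig_poly (\<lambda>t. c * q t)"
  by (rule trig_poly_mult[OF trig_poly_const])

text \<open>A real linear functional is a combination of \<open>Re\<close> and \<open>Im\<close>,
  which on the circle are combinations of the characters of frequency 1 and -1.\<close>

lemma trig_poly_real_polynomial:
  fixes g :: "complex \<Rightarrow> real"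
  assumes "real_polynomial_function g"
  shows "trig_poly (\<lambda>t. complex_of_real (g (e_unit t)))"
  using assms
proof (induction rule: real_polynomial_function.induct)
  case (linear f)
  interpret f: bounded_linear f by fact
  have f: "f z = Re z * f 1 + Im z * f \<i>" for z
  proof -
    have "z = Re z *\<^sub>R 1 + Im z *\<^sub>R \<i>" by (simp add: complex_eq_iff)
    then have "f z = f (Re z *\<^sub>R 1 + Im z *\<^sub>R \<i>)" by (rule arg_cong)
    then show ?thesis by (simp only: f.add f.scaleR real_scaleR_def)
  qed
  have "complex_of_real (f (e_unit t)) =
      ((f 1 - \<i> * f \<i>) / 2) * e_unit (of_int 1 * t) + ((f 1 + \<i> * f \<i>) / 2) * e_unit (of_int (-1) * t)" for t
    by (subst f) (simp add: complex_eq_iff e_unit_eq_cis field_simps)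
  then show ?case using trig_poly.add[OF trig_poly.char trig_poly.char] by presburger
next
  case (add f g)
  then show ?case using trig_poly.add by simp
next
  case (mult f g)
  then show ?case using trig_poly_mult by simp
qed (rule trig_poly_const)

lemma trig_poly_polynomial_function:
  fixes p :: "complex \<Rightarrow> complex"
  assumes "polynomial_function p"
  shows "trig_poly (\<lambda>t. p (e_unit t))"
proof -
  have "real_polynomial_function (Re \<circ> p)" "real_polynomial_function (Im \<circ> p)"
    using assms bounded_linear_Re bounded_linear_Im by (auto simp: polynomial_function_def)
  then have "trig_poly (\<lambda>t. complex_of_real (Re (p (e_unit t))) + \<i> * complex_of_real (Im (p (e_unit t))))"
    by (intro trig_poly.add trig_poly_cmult) (auto dest: trig_poly_real_polynomial)
  then show ?thesis by (simp flip: complex_eq)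
qed

section \<open>Cutting out the jump of the fractional part\<close>

lemma Arg2pi_e_unit: "Arg2pi (e_unit t) = 2 * pi * frac t"
proof (rule Arg2pi_unique[of 1])
  have "e_unit t = e_unit (frac t + of_int \<lfloor>t\<rfloor>)" by (simp add: frac_def)
  also have "\<dots> = e_unit (frac t)"
    unfolding e_unit_add by (simp add: e_unit_eq_cis cis_multiple_2pi)
  finally show "of_real 1 * exp (\<i> * of_real (2 * pi * frac t)) = e_unit t"
    by (simp add: e_unit_def mult_ac)
qed (use frac_lt_1 in auto)

text \<open>A tent at \<open>z = 1\<close>, the point of the circle that corresponds to the
  integers. Its width of order \<open>1 / K\<close> is chosen to fit under the Fejer kernel of order
  \<open>K\<close>.\<close>

definition circle_bump :: "nat \<Rightarrow> complex \<Rightarrow> real" where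
  "circle_bump K z = max 0 (1 - 2 * real K * norm (z - 1))"

text \<open>Where the bump is positive, \<open>norm (z - 1)\<close> is below
  \<open>1 / (2 * K)\<close>, so each \<open>z ^ j\<close> with \<open>j < K\<close> is within
  \<open>1 / 2\<close> of 1 and their sum has norm at least \<open>K / 2\<close>. The factor 4 makes
  the right side at least 1 there.\<close>

lemma circle_bump_le_Fejer:
  assumes z: "norm z = 1" and "K > 0"
  shows "circle_bump K z \<le> 4 * (norm (\<Sum>j<K. z ^ j) / K)\<^sup>2"
proof (cases "2 * real K * norm (z - 1) \<le> 1")
  case True
  have "norm (z ^ j - 1) \<le> 1 / 2" if "j < K" for j
  proof -
    have "norm (z ^ j - 1 ^ j) \<le> j * norm (z - 1)" using z by (intro norm_power_diff) auto
    also have "\<dots> \<le> K * norm (z - 1)" using that by (intro mult_right_mono) auto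
    finally show ?thesis using True by simp
  qed
  then have "norm (\<Sum>j<K. z ^ j - 1) \<le> (\<Sum>j<K. 1 / 2)" by (intro sum_norm_le) auto
  then have "norm ((\<Sum>j<K. z ^ j) - of_nat K) \<le> K / 2" by (simp add: sum_subtractf)
  then have "norm (\<Sum>j<K. z ^ j) \<ge> K / 2"
    using norm_triangle_ineq2[of "of_nat K" "of_nat K - (\<Sum>j<K. z ^ j)"] by (simp add: norm_minus_commute)
  then have "norm (\<Sum>j<K. z ^ j) / K \<ge> 1 / 2" using \<open>K > 0\<close> by (simp add: field_simps)
  then have "(norm (\<Sum>j<K. z ^ j) / K)\<^sup>2 \<ge> (1 / 2)\<^sup>2" by (intro power_mono) auto
  then have "4 * (norm (\<Sum>j<K. z ^ j) / K)\<^sup>2 \<ge> 1" by (simp only: power_one_over) simp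
  moreover have "circle_bump K z \<le> 1" by (simp add: circle_bump_def)
  ultimately show ?thesis by linarith
qed (simp add: circle_bump_def)

lemma e_unit_power: "e_unit t ^ j = e_unit (real j * t)"
  by (induction j) (simp_all add: e_unit_add distrib_right)

text \<open>Expanding the square gives frequencies \<open>i - j\<close>; in the limit only the
  \<open>K\<close> diagonal terms survive, out of a normalisation by \<open>K * K\<close>.\<close>

lemma cesaro_Fejer:
  assumes equi: "\<And>\<beta>. \<beta> \<noteq> 0 \<Longrightarrow> cesaro (\<lambda>n. e_unit (\<beta> * x n)) \<longlonglongrightarrow> 0" and "K > 0"
  shows "cesaro (\<lambda>n. of_real ((norm (\<Sum>j<K. e_unit (x n) ^ j) / K)\<^sup>2)) \<longlonglongrightarrow> 1 / of_nat K"
proof -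
  have 1: "cesaro (\<lambda>n. e_unit ((real i - real j) * x n)) \<longlonglongrightarrow> (if i = j then 1 else 0)" for i j
  proof (cases "i = j")
    case True
    have "\<forall>\<^sub>F N in sequentially. cesaro (\<lambda>n. 1) N = 1"
      using eventually_gt_at_top[of 0] by eventually_elim (rule cesaro_const)
    then show ?thesis using True by (simp add: tendsto_eventually)
  qed (use equi in simp)
  have "(\<lambda>N. (1 / (of_nat K)\<^sup>2) * (\<Sum>i<K. \<Sum>j<K. cesaro (\<lambda>n. e_unit ((real i - real j) * x n)) N))
      \<longlonglongrightarrow> (1 / (of_nat K)\<^sup>2) * (\<Sum>i<K. \<Sum>j<K. if i = j then 1 else 0)"
    by (intro tendsto_intros 1)
  moreover have eq: "complex_of_real ((norm (\<Sum>j<K. e_unit (x n) ^ j) / K)\<^sup>2) =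
      (1 / (of_nat K)\<^sup>2) * (\<Sum>i<K. \<Sum>j<K. e_unit ((real i - real j) * x n))" for n
  proof -
    have "complex_of_real ((norm (\<Sum>j<K. e_unit (x n) ^ j))\<^sup>2) =
        (\<Sum>i<K. \<Sum>j<K. e_unit ((real i - real j) * x n))"
      unfolding complex_norm_square
      by (simp add: sum_product e_unit_power e_unit_diff left_diff_distrib)
    then show ?thesis by (simp add: power_divide)
  qed
  moreover have "(\<Sum>i<K. \<Sum>j<K. if i = j then 1 else 0 :: complex) = of_nat K"
    by simp
  ultimately show ?thesis
    using \<open>K > 0\<close> unfolding eq cesaro_cmult[abs_def] cesaro_sum by (simp add: power2_eq_square)
qed

text \<open>On the circle \<open>Arg2pi\<close> jumps only at 1, and there the factor
  \<open>1 - circle_bump K z\<close> is at most \<open>2 * K * norm (z - 1)\<close>.\<close>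

lemma continuous_circle_sawtooth:
  assumes "K > 0"
  shows "continuous_on (sphere 0 1) (\<lambda>z. e_unit (- \<alpha> * (Arg2pi z / (2 * pi))) * of_real (1 - circle_bump K z))"
    (is "continuous_on _ ?\<phi>")
proof (rule continuous_at_imp_continuous_on, rule ballI)
  fix z :: complex assume z: "z \<in> sphere 0 1"
  show "isCont ?\<phi> z"
  proof (cases "z = 1")
    case False
    have "z \<notin> \<real>\<^sub>\<ge>\<^sub>0"
      using z False by (auto simp: complex_nonneg_Reals_iff cmod_eq_Re complex_eq_iff)
    then have "isCont Arg2pi z" by (rule continuous_at_Arg2pi)
    then have "isCont (\<lambda>z. - \<alpha> * (Arg2pi z / (2 * pi))) z" by (intro continuous_intros) auto
    then have "isCont (\<lambda>z. e_unit (- \<alpha> * (Arg2pi z / (2 * pi)))) z"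
      by (rule isCont_o2[OF _ isCont_e_unit])
    moreover have "isCont (\<lambda>z. of_real (1 - circle_bump K z) :: complex) z"
      unfolding circle_bump_def by (intro continuous_intros)
    ultimately show ?thesis by (rule continuous_mult)
  next
    case True
    have "(?\<phi> \<longlongrightarrow> 0) (at 1)"
    proof (rule Lim_null_comparison)
      show "\<forall>\<^sub>F z in at 1. norm (?\<phi> z) \<le> 2 * real K * norm (z - 1)"
      proof (intro always_eventually allI)
        fix z :: complex
        have "norm (?\<phi> z) = \<bar>1 - circle_bump K z\<bar>" by (simp only: norm_mult norm_e_unit norm_of_real mult_1)
        also have "\<dots> \<le> 2 * real K * norm (z - 1)"
          using mult_nonneg_nonneg[of "2 * real K" "norm (z - 1)"] by (simp add: circle_bump_def max_def)
        finally show "norm (?\<phi> z) \<le> 2 * real K * norm (z - 1)" .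
      qed
      have "((\<lambda>z::complex. 2 * real K * norm (z - 1)) \<longlongrightarrow> 2 * real K * norm (1 - 1 :: complex)) (at 1)"
        by (intro tendsto_intros)
      then show "((\<lambda>z::complex. 2 * real K * norm (z - 1)) \<longlongrightarrow> 0) (at 1)" by simp
    qed
    moreover have "?\<phi> 1 = 0" by (simp add: circle_bump_def)
    ultimately show ?thesis using True by (simp only: isCont_def)
  qed
qed

text \<open>The polynomial part is handled by \<open>twisted\<close>. Near the jump only the size of
  \<open>v\<close> is available, so \<open>equi\<close> controls how often the points
  \<open>x n\<close> come close to integers.\<close>

theorem cesaro_floor:
  fixes x :: "nat \<Rightarrow> real" and v :: "nat \<Rightarrow> complex"
  assumes twisted: "\<And>\<beta>. \<beta> \<noteq> 0 \<Longrightarrow> cesaro (\<lambda>n. e_unit (\<beta> * x n) * v n) \<longlonglongrightarrow> 0"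
    and equi: "\<And>\<beta>. \<beta> \<noteq> 0 \<Longrightarrow> cesaro (\<lambda>n. e_unit (\<beta> * x n)) \<longlonglongrightarrow> 0"
    and v: "\<And>n. n \<ge> 1 \<Longrightarrow> norm (v n) \<le> 1" and \<alpha>: "\<alpha> \<notin> \<int>"
  shows "cesaro (\<lambda>n. e_unit (of_int \<lfloor>x n\<rfloor> * \<alpha>) * v n) \<longlonglongrightarrow> 0"
proof (rule tendstoI)
  fix e :: real assume e: "e > 0"
  \<comment> \<open>The Fejer average \<open>1 / K\<close> enters with factor 4 and must stay below
    \<open>e / 4\<close>; the approximation error and the main average take \<open>e / 4\<close>
    each.\<close>
  obtain K :: nat where K: "real K > 16 / e" using reals_Archimedean2 by blast
  then have "K > 0" using e by (metis divide_pos_pos less_trans of_nat_0_less_iff zero_less_numeral)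
  have K': "4 / real K < e / 4" using K e \<open>K > 0\<close> by (simp add: field_simps)
  define \<psi> where "\<psi> z = e_unit (- \<alpha> * (Arg2pi z / (2 * pi)))" for z
  obtain p where p: "polynomial_function p"
    "\<And>z. z \<in> sphere 0 1 \<Longrightarrow> norm (\<psi> z * of_real (1 - circle_bump K z) - p z) < e / 4"
    using Stone_Weierstrass_polynomial_function[OF compact_sphere continuous_circle_sawtooth[OF \<open>K > 0\<close>, of \<alpha>], of "e / 4"] e
    unfolding \<psi>_def by auto
  have "cesaro (\<lambda>n. e_unit (\<alpha> * x n) * q (x n) * v n) \<longlonglongrightarrow> 0" if "trig_poly q" for q
    using that
  proof (induction rule: trig_poly.induct)
    case (char c k)
    \<comment> \<open>Here \<open>\<alpha> \<notin> \<int>\<close> enters: no character of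
      \<open>\<psi>\<close> cancels the phase completely.\<close>
    have "\<alpha> + of_int k \<noteq> 0" using \<alpha> by (metis Ints_of_int add.inverse_inverse add_eq_0_iff Ints_minus)
    from tendsto_mult_right_zero[OF twisted[OF this], of c]
    have "cesaro (\<lambda>n. c * (e_unit ((\<alpha> + of_int k) * x n) * v n)) \<longlonglongrightarrow> 0"
      by (simp only: cesaro_cmult[abs_def])
    moreover have "c * (e_unit ((\<alpha> + of_int k) * x n) * v n) =
        e_unit (\<alpha> * x n) * (c * e_unit (of_int k * x n)) * v n" for n
      by (simp add: distrib_right e_unit_add)
    ultimately show ?case by (simp only:)
  next
    case (add q1 q2)
    from tendsto_add[OF add.IH] show ?case
      by (simp add: cesaro_add[symmetric, abs_def] algebra_simps)
  qed
  from this[OF trig_poly_polynomial_function[OF p(1)]]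
  have main: "cesaro (\<lambda>n. e_unit (\<alpha> * x n) * p (e_unit (x n)) * v n) \<longlonglongrightarrow> 0" .
  define fej where "fej n = (norm (\<Sum>j<K. e_unit (x n) ^ j) / K)\<^sup>2" for n
  define R where "R n = e_unit (of_int \<lfloor>x n\<rfloor> * \<alpha>) * v n - e_unit (\<alpha> * x n) * p (e_unit (x n)) * v n" for n
  have R: "norm (R n) \<le> e / 4 + 4 * fej n" if "n \<ge> 1" for n
  proof -
    define z where "z = e_unit (x n)"
    have z: "norm z = 1" by (simp add: z_def)
    have "Arg2pi z / (2 * pi) = x n - of_int \<lfloor>x n\<rfloor>"
      by (simp add: z_def Arg2pi_e_unit frac_def)
    then have "of_int \<lfloor>x n\<rfloor> * \<alpha> = \<alpha> * x n + - \<alpha> * (Arg2pi z / (2 * pi))"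
      by (simp only:) (simp add: algebra_simps)
    then have "e_unit (of_int \<lfloor>x n\<rfloor> * \<alpha>) = e_unit (\<alpha> * x n) * \<psi> z"
      by (simp only: e_unit_add \<psi>_def)
    then have "R n = e_unit (\<alpha> * x n) * (\<psi> z - p z) * v n"
      by (simp add: R_def z_def algebra_simps)
    then have "norm (R n) \<le> norm (\<psi> z - p z)"
      using v[OF that] by (simp add: norm_mult mult_left_le)
    also have "\<psi> z - p z = (\<psi> z * of_real (1 - circle_bump K z) - p z) + \<psi> z * of_real (circle_bump K z)"
      by (simp add: algebra_simps)
    also have "norm \<dots> \<le> e / 4 + circle_bump K z"
    proof (rule norm_triangle_mono)
      show "norm (\<psi> z * of_real (1 - circle_bump K z) - p z) \<le> e / 4"
        using p(2)[of z] z by simp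
      show "norm (\<psi> z * of_real (circle_bump K z)) \<le> circle_bump K z"
        by (simp add: norm_mult \<psi>_def circle_bump_def)
    qed
    also have "circle_bump K z \<le> 4 * fej n"
      unfolding fej_def z_def[symmetric] by (rule circle_bump_le_Fejer[OF z \<open>K > 0\<close>])
    finally show ?thesis by simp
  qed
  have "(\<lambda>N. 4 * Re (cesaro (\<lambda>n. of_real (fej n)) N)) \<longlonglongrightarrow> 4 * Re (1 / of_nat K)"
    unfolding fej_def by (intro tendsto_intros cesaro_Fejer equi \<open>K > 0\<close>)
  then have "\<forall>\<^sub>F N in sequentially. 4 * Re (cesaro (\<lambda>n. of_real (fej n)) N) < e / 4"
    using K' by (intro order_tendstoD) (auto simp: Re_divide_of_nat)
  moreover have "\<forall>\<^sub>F N in sequentially. dist (cesaro (\<lambda>n. e_unit (\<alpha> * x n) * p (e_unit (x n)) * v n) N) 0 < e / 4"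
    using main e by (intro tendstoD) auto
  moreover have "\<forall>\<^sub>F N::nat in sequentially. N > 0" by (rule eventually_gt_at_top)
  ultimately show "\<forall>\<^sub>F N in sequentially. dist (cesaro (\<lambda>n. e_unit (of_int \<lfloor>x n\<rfloor> * \<alpha>) * v n) N) 0 < e"
  proof eventually_elim
    case (elim N)
    have "norm (cesaro R N) \<le> Re (cesaro (\<lambda>n. of_real (e / 4 + 4 * fej n)) N)"
      by (rule norm_cesaro_le_Re) (rule R)
    also have "\<dots> = e / 4 + 4 * Re (cesaro (\<lambda>n. of_real (fej n)) N)"
      using elim by (simp only: of_real_add of_real_mult cesaro_add cesaro_cmult cesaro_const) simp
    finally have "norm (cesaro R N) < e / 2" using elim by simp
    moreover have "cesaro R N = cesaro (\<lambda>n. e_unit (of_int \<lfloor>x n\<rfloor> * \<alpha>) * v n) N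
        - cesaro (\<lambda>n. e_unit (\<alpha> * x n) * p (e_unit (x n)) * v n) N"
      unfolding R_def by (rule cesaro_diff)
    ultimately show ?case
      using elim e norm_triangle_sub[of "cesaro (\<lambda>n. e_unit (of_int \<lfloor>x n\<rfloor> * \<alpha>) * v n) N"
          "cesaro (\<lambda>n. e_unit (\<alpha> * x n) * p (e_unit (x n)) * v n) N"] by simp
  qed
qed

theorem corollary1p3:
  fixes a :: "real \<Rightarrow> real" and b w :: "nat \<Rightarrow> complex"
  assumes "Hardy_field_function a"
    and "(\<exists>d::nat. (\<lambda>t. t ^ d * ln t) \<prec>\<^sub>g a \<and> a \<prec>\<^sub>g (\<lambda>t. t ^ (d + 1))) \<or>
         (\<exists>d::nat. d \<ge> 1 \<and> a \<sim>\<^sub>g (\<lambda>t. t ^ d * ln t))"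
    and "(\<forall>n\<ge>1. b n = e_unit (a (real n))) \<or>
         (\<exists>\<alpha>::real. \<alpha> \<notin> \<int> \<and> (\<forall>n\<ge>1. b n = e_unit (of_int \<lfloor>a (real n)\<rfloor> * \<alpha>)))"
    and "\<forall>n\<ge>1. w n \<in> unit_disc"
    and "ergodic_seq w"
  shows "(\<lambda>N. (\<Sum>n=1..N. b n * w n) / of_nat N) \<longlonglongrightarrow> 0"
proof -
  interpret ergodic_sequence w by standard (use assms in auto)
  obtain \<sigma> where \<sigma>: "\<sigma> \<in> {1, -1 :: real}" "admissible_seq (\<lambda>n. \<sigma> * a (real n))"
    using Hardy_function_admissible[OF assms(1,2)] by blast
  have lim: "cesaro (\<lambda>n. e_unit (\<beta> * a (real n)) * F (orb n)) \<longlonglongrightarrow> 0"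
    if "\<beta> \<noteq> 0" "continuous_on seq_space F" "\<And>x. x \<in> seq_space \<Longrightarrow> norm (F x) \<le> 1" for \<beta> F
  proof -
    \<comment> \<open>Since \<open>\<sigma> * \<sigma> = 1\<close>, the sign that made
      \<open>a\<close> admissible is absorbed into the frequency.\<close>
    have "\<beta> * \<sigma> \<noteq> 0" and eq: "\<beta> * \<sigma> * (\<sigma> * a (real n)) = \<beta> * a (real n)" for n
      using \<sigma>(1) that(1) by auto
    from cesaro_admissible[OF \<sigma>(2) this(1), of F] that show ?thesis by (simp only: eq)
  qed
  have twisted: "cesaro (\<lambda>n. e_unit (\<beta> * a (real n)) * w n) \<longlonglongrightarrow> 0" if "\<beta> \<noteq> 0" for \<beta>
  proof -
    \<comment> \<open>The sequence itself is recovered by evaluating orbit points at the coordinate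
      0.\<close>
    have "cesaro (\<lambda>n. e_unit (\<beta> * a (real n)) * orb n 0) \<longlonglongrightarrow> 0"
      by (rule lim[OF that, of "\<lambda>x. x 0"])
         (auto simp: seq_space_def unit_disc_def intro: continuous_on_subset[OF continuous_on_product_coordinates])
    moreover have "cesaro (\<lambda>n. e_unit (\<beta> * a (real n)) * orb n 0) = cesaro (\<lambda>n. e_unit (\<beta> * a (real n)) * w n)"
      by (intro ext cesaro_cong) (simp add: orb_0)
    ultimately show ?thesis by simp
  qed
  have equi: "cesaro (\<lambda>n. e_unit (\<beta> * a (real n))) \<longlonglongrightarrow> 0" if "\<beta> \<noteq> 0" for \<beta>
    using lim[OF that, of "\<lambda>_. 1"] by simp
  have "cesaro (\<lambda>n. b n * w n) \<longlonglongrightarrow> 0"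
    using assms(3)
  proof (elim disjE exE conjE)
    assume b: "\<forall>n\<ge>1. b n = e_unit (a (real n))"
    have "cesaro (\<lambda>n. b n * w n) = cesaro (\<lambda>n. e_unit (1 * a (real n)) * w n)"
      by (intro ext cesaro_cong) (simp add: b)
    then show ?thesis using twisted[of 1] by simp
  next
    fix \<alpha> :: real
    assume \<alpha>: "\<alpha> \<notin> \<int>" and b: "\<forall>n\<ge>1. b n = e_unit (of_int \<lfloor>a (real n)\<rfloor> * \<alpha>)"
    have "cesaro (\<lambda>n. b n * w n) = cesaro (\<lambda>n. e_unit (of_int \<lfloor>a (real n)\<rfloor> * \<alpha>) * w n)"
      by (intro ext cesaro_cong) (simp add: b)
    moreover have "norm (w n) \<le> 1" if "n \<ge> 1" for n
      using in_disc[OF that] by (simp add: unit_disc_def)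
    ultimately show ?thesis using cesaro_floor[OF twisted equi _ \<alpha>] by simp
  qed
  then show ?thesis by (simp add: cesaro_def[abs_def])
qed

end
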